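(* For every integer $n\ge1$, $$\sum_{\sigma\in\mathfrak{S}_n}(-1)^{\mathrm{wex}\,\sigma}p^{\mathrm{nest}\,\sigma}q^{\mathrm{cros}\,\sigma}=\begin{cases}0&\text{if $n$ is even},\\[2pt](-1)^{\frac{n+1}{2}}\displaystyle\sum_{\sigma\in\mathfrak{A}_n}p^{(2\text{-}13)\sigma}q^{(31\text{-}2)\sigma}&\text{if $n$ is odd},\end{cases}$$ and $$\sum_{\sigma\in\mathfrak{D}_n}(-1/q)^{\mathrm{exc}\,\sigma}p^{\mathrm{nest}\,\sigma}q^{\mathrm{cros}\,\sigma}=\begin{cases}(-1/q)^{\frac n2}\displaystyle\sum_{\sigma\in\mathfrak{A}_n}p^{(2\text{-}31)\sigma}q^{(31\text{-}2)\sigma}&\text{if $n$ is even},\\[2pt]0&\text{if $n$ is odd}.\end{cases}$$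
   Context: Let $\mathfrak{S}_n$ be the set of permutations $\sigma=\sigma(1)\cdots\sigma(n)$ of $[n]=\{1,\dots,n\}$, and $\mathfrak{D}_n$ the subset of derangements ($\sigma(i)\ne i$ for all $i$). $\mathfrak{A}_n$ is the set of (falling) alternating permutations: $\sigma\in\mathfrak{S}_n$ with $\sigma(1)>\sigma(2)$, $\sigma(2)<\sigma(3)$, $\sigma(3)>\sigma(4)$, etc. $\mathrm{wex}\,\sigma=\#\{i\in[n]: i\le\sigma(i)\}$; $\mathrm{exc}\,\sigma=\#\{i\in[n]: i<\sigma(i)\}$; $\mathrm{cros}\,\sigma=\#\{(i,j)\in[n]^2: (i<j\le\sigma(i)<\sigma(j))\text{ or }(i>j>\sigma(i)>\sigma(j))\}$; $\mathrm{nest}\,\sigma=\#\{(i,j)\in[n]^2: (i<j\le\sigma(j)<\sigma(i))\text{ or }(i>j>\sigma(j)>\sigma(i))\}$; $(31\text{-}2)\sigma$ is the number of pairs $(i,j)$ with $2\le i<j\le n$ and $\sigma(i-1)>\sigma(j)>\sigma(i)$; $(2\text{-}13)\sigma$ (resp. $(2\text{-}31)\sigma$) is the number of pairs $(i,j)$ with $1\le i<j\le n-1$ and $\sigma(j+1)>\sigma(i)>\sigma(j)$ (resp. $\sigma(j+1)<\sigma(i)<\sigma(j)$). Here $p,q$ are indeterminates. *)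

theory Defs
  imports "HOL-Combinatorics.Permutations" "HOL-Computational_Algebra.Polynomial_Factorial"
begin

text \<open>
  A permutation of \<open>[n]\<close> is a function \<open>\<sigma> :: nat \<Rightarrow> nat\<close> with \<open>\<sigma> permutes {1..n}\<close>, so it is the
  identity outside \<open>{1..n}\<close>. The statistics therefore take \<open>n\<close> as an extra argument.
\<close>

definition perms :: "nat \<Rightarrow> (nat \<Rightarrow> nat) set" where
  "perms n = {\<sigma>. \<sigma> permutes {1..n}}"

definition derangements :: "nat \<Rightarrow> (nat \<Rightarrow> nat) set" where
  "derangements n = {\<sigma> \<in> perms n. \<forall>i\<in>{1..n}. \<sigma> i \<noteq> i}"

definition falling_alternating :: "nat \<Rightarrow> (nat \<Rightarrow> nat) set" where
  "falling_alternating n = {\<sigma> \<in> perms n. \<forall>i\<in>{1..<n}.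
     (odd i \<longrightarrow> \<sigma> i > \<sigma> (i + 1)) \<and> (even i \<longrightarrow> \<sigma> i < \<sigma> (i + 1))}"

definition wex :: "nat \<Rightarrow> (nat \<Rightarrow> nat) \<Rightarrow> nat" where
  "wex n \<sigma> = card {i \<in> {1..n}. i \<le> \<sigma> i}"

definition exc :: "nat \<Rightarrow> (nat \<Rightarrow> nat) \<Rightarrow> nat" where
  "exc n \<sigma> = card {i \<in> {1..n}. i < \<sigma> i}"

definition cros :: "nat \<Rightarrow> (nat \<Rightarrow> nat) \<Rightarrow> nat" where
  "cros n \<sigma> = card {(i, j) \<in> {1..n} \<times> {1..n}.
     (i < j \<and> j \<le> \<sigma> i \<and> \<sigma> i < \<sigma> j) \<or> (i > j \<and> j > \<sigma> i \<and> \<sigma> i > \<sigma> j)}"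

definition nest :: "nat \<Rightarrow> (nat \<Rightarrow> nat) \<Rightarrow> nat" where
  "nest n \<sigma> = card {(i, j) \<in> {1..n} \<times> {1..n}.
     (i < j \<and> j \<le> \<sigma> j \<and> \<sigma> j < \<sigma> i) \<or> (i > j \<and> j > \<sigma> j \<and> \<sigma> j > \<sigma> i)}"

definition pat_31_2 :: "nat \<Rightarrow> (nat \<Rightarrow> nat) \<Rightarrow> nat" where
  "pat_31_2 n \<sigma> = card {(i, j). 2 \<le> i \<and> i < j \<and> j \<le> n \<and>
     \<sigma> (i - 1) > \<sigma> j \<and> \<sigma> j > \<sigma> i}"

definition pat_2_13 :: "nat \<Rightarrow> (nat \<Rightarrow> nat) \<Rightarrow> nat" where
  "pat_2_13 n \<sigma> = card {(i, j). 1 \<le> i \<and> i < j \<and> j \<le> n - 1 \<and>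
     \<sigma> (j + 1) > \<sigma> i \<and> \<sigma> i > \<sigma> j}"

definition pat_2_31 :: "nat \<Rightarrow> (nat \<Rightarrow> nat) \<Rightarrow> nat" where
  "pat_2_31 n \<sigma> = card {(i, j). 1 \<le> i \<and> i < j \<and> j \<le> n - 1 \<and>
     \<sigma> (j + 1) < \<sigma> i \<and> \<sigma> i < \<sigma> j}"

text \<open>
  Two independent indeterminates \<open>p\<close>, \<open>q\<close> over the integers, as elements of the fraction field of
  \<open>\<int>[p][q]\<close>; the fraction field is needed for \<open>1 / q\<close>. The inner polynomial variable is \<open>p\<close>, the
  outer one is \<open>q\<close>.
\<close>

definition indet_p :: "int poly poly fract" where
  "indet_p = to_fract [:[:0, 1:]:]"

definition indet_q :: "int poly poly fract" where
  "indet_q = to_fract [:0, 1:]"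

end

theory Submission
  imports Defs
begin

text \<open>
  Both sides are counted by weighted lattice paths, generated by iterating a tridiagonal operator
  \<open>step a b c\<close> on functions of the height. Write \<open>[h]\<close> for the sum of \<open>p\<^sup>i q\<^sup>j\<close> over \<open>i + j = h - 1\<close>.

  Scan a permutation \<open>\<sigma>\<close> through \<open>k = 1, \<dots>, n\<close>, revealing only the arcs inside \<open>{1..k}\<close>. If \<open>h\<close>
  positions and \<open>h\<close> values are still unmatched, closing an arc at the unmatched element of rank \<open>r\<close>
  costs \<open>p\<^sup>r q\<^sup>h\<^sup>-\<^sup>1\<^sup>-\<^sup>r\<close>. With weight \<open>y\<close> per excedance and \<open>z\<close> per fixed point, the paths have level
  weight \<open>y q [h] + z p\<^sup>h + [h]\<close> and weight \<open>y [h]\<^sup>2\<close> for the edge between \<open>h - 1\<close> and \<open>h\<close>. For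
  \<open>y = -1/q\<close>, \<open>z = 0\<close> the level weights vanish. For \<open>y = z = -1\<close> they equal \<open>[h] - [h+1]\<close>; the operator
  factors into two bidiagonal ones, and exchanging the factors leaves paths without level steps
  whose edge weight is \<open>-[h][h+1]\<close>.

  Build an alternating permutation by inserting the letters in decreasing order. The letters present
  form blocks; a new letter either opens a block (a peak) or joins two neighbouring blocks (a
  valley), and the number of blocks to its left and right gives the exponents of \<open>q\<close> and \<open>p\<close>. After
  rescaling, the edge weights are \<open>[h][h+1]\<close> for odd \<open>n\<close> and \<open>[h]\<^sup>2\<close> for even \<open>n\<close>.
\<close>

section \<open>Weighted lattice paths\<close>

context
  fixes p q :: "'a::comm_ring_1"
begin

text \<open>The \<open>p,q\<close>-analogue of \<open>n\<close>, that is
  \<open>(p^n - q^n) / (p - q)\<close>, written without division.\<close>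

primrec bracket :: "nat \<Rightarrow> 'a" where
  "bracket 0 = 0"
| "bracket (Suc n) = q * bracket n + p ^ n"

definition rank_wt :: "nat set \<Rightarrow> nat \<Rightarrow> 'a" where
  "rank_wt S i = p ^ card {j\<in>S. j < i} * q ^ card {j\<in>S. i < j}"

text \<open>A new largest element multiplies every earlier term by \<open>q\<close> and adds
  \<open>p ^ card S\<close>, which is the recursion of \<open>bracket\<close>.\<close>

lemma sum_rank_wt:
  assumes "finite S"
  shows "(\<Sum>i\<in>S. rank_wt S i) = bracket (card S)"
  using assms
proof (induction S rule: finite_linorder_max_induct)
  case (insert m S)
  have [simp]: "m \<notin> S" using insert.hyps by auto
  have "rank_wt (insert m S) i = q * rank_wt S i" if "i \<in> S" for i
  proof -
    have "{j \<in> insert m S. j < i} = {j\<in>S. j < i}" "{j \<in> insert m S. i < j} = insert m {j\<in>S. i < j}"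
      using insert.hyps that by (auto dest: order.asym)
    then show ?thesis using insert.hyps(1) by (simp add: rank_wt_def algebra_simps)
  qed
  moreover have "rank_wt (insert m S) m = p ^ card S"
  proof -
    have "{j \<in> insert m S. j < m} = S" "{j \<in> insert m S. m < j} = {}"
      using insert.hyps by (auto dest: order.asym)
    then show ?thesis unfolding rank_wt_def by (simp only:) simp
  qed
  ultimately show ?case using insert by (simp add: sum_distrib_left [symmetric])
qed simp

end

text \<open>Transfer operator of weighted paths: \<open>(step a b c ^^ n) \<phi> h\<close> sums over
  the paths of \<open>n\<close> steps from \<open>h\<close>, with \<open>\<phi>\<close> evaluated at
  the end. Truncated subtraction turns \<open>c 0\<close> into a second level weight at height
  \<open>0\<close>, hence the assumptions \<open>c 0 = 0\<close>.\<close>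

definition step ::
  "(nat \<Rightarrow> 'a) \<Rightarrow> (nat \<Rightarrow> 'a) \<Rightarrow> (nat \<Rightarrow> 'a) \<Rightarrow> (nat \<Rightarrow> 'a) \<Rightarrow> nat \<Rightarrow> 'a::comm_ring_1" where
  "step a b c \<phi> h = a h * \<phi> (Suc h) + b h * \<phi> h + c h * \<phi> (h - 1)"

lemma funpow_step_Suc:
  "(step a b c ^^ Suc n) \<phi> h =
    a h * (step a b c ^^ n) \<phi> (Suc h) + b h * (step a b c ^^ n) \<phi> h + c h * (step a b c ^^ n) \<phi> (h - 1)"
  by (simp only: funpow.simps comp_apply step_def)

text \<open>Conjugation by the diagonal matrix with entries \<open>prod a {..<h}\<close>: only the
  product of the two weights of an edge matters, so all of it moves to the down step. Multiplying by
  the entries avoids inverting them.\<close>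

lemma funpow_step_conjugate:
  assumes "c 0 = 0"
  shows "(step a b c ^^ n) \<phi> h * prod a {..<h} =
    (step (\<lambda>_. 1) b (\<lambda>h. a (h - 1) * c h) ^^ n) (\<lambda>h. \<phi> h * prod a {..<h}) h"
proof -
  define f where "f n = (step a b c ^^ n) \<phi>" for n
  define g where "g n = (step (\<lambda>_. 1) b (\<lambda>h. a (h - 1) * c h) ^^ n) (\<lambda>h. \<phi> h * prod a {..<h})" for n
  have f_Suc: "f (Suc n) h = a h * f n (Suc h) + b h * f n h + c h * f n (h - 1)" for n h
    unfolding f_def by (rule funpow_step_Suc)
  have g_Suc: "g (Suc n) h = g n (Suc h) + b h * g n h + a (h - 1) * c h * g n (h - 1)" for n h
    unfolding g_def by (subst funpow_step_Suc) simp
  have "f n h * prod a {..<h} = g n h"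
  proof (induction n arbitrary: h)
    case (Suc n)
    have "c h * f n (h - 1) * prod a {..<h} = a (h - 1) * c h * (f n (h - 1) * prod a {..<h - 1})"
      using assms by (cases h) (simp_all add: algebra_simps)
    then show ?case
      unfolding f_Suc g_Suc Suc.IH [symmetric] by (simp add: algebra_simps)
  qed (simp add: f_def g_def)
  then show ?thesis by (simp only: f_def g_def)
qed

lemma funpow_step_mult:
  "(step a b c ^^ n) (\<lambda>h. k * \<phi> h) h = k * (step a b c ^^ n) \<phi> h"
  by (induction n arbitrary: h) (simp_all add: funpow_step_Suc algebra_simps del: funpow.simps(2))

text \<open>The zero weight \<open>c k\<close> closes the way below \<open>k\<close>, so heights can
  be measured from \<open>k\<close>.\<close>

lemma funpow_step_shift:
  assumes "c k = 0"
  shows "(step a b c ^^ n) \<phi> (h + k) =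
    (step (\<lambda>h. a (h + k)) (\<lambda>h. b (h + k)) (\<lambda>h. c (h + k)) ^^ n) (\<lambda>h. \<phi> (h + k)) h"
proof (induction n arbitrary: h)
  case (Suc n)
  show ?case
    unfolding funpow_step_Suc Suc.IH [symmetric] using assms by (cases h) simp_all
qed simp

text \<open>Without level steps, a path of \<open>n\<close> steps from \<open>h\<close> to
  \<open>0\<close> needs \<open>n + h\<close> even and has \<open>(n + h) div 2\<close> down steps,
  each contributing one \<open>y\<close>.\<close>

lemma funpow_step_scale:
  assumes "c 0 = 0" and "\<And>h. h > 0 \<Longrightarrow> \<phi> h = 0"
  shows "(step (\<lambda>_. 1) (\<lambda>_. 0) (\<lambda>h. y * c h) ^^ n) \<phi> h =
    (if even (n + h) then y ^ ((n + h) div 2) else 0) * (step (\<lambda>_. 1) (\<lambda>_. 0) c ^^ n) \<phi> h"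
proof (induction n arbitrary: h)
  case 0
  then show ?case using assms(2)[of h] by (cases h) auto
next
  case (Suc n)
  show ?case
  proof (cases h)
    case 0
    then show ?thesis using assms(1) by (simp add: funpow_step_Suc Suc del: funpow.simps)
  next
    case (Suc k)
    then show ?thesis by (simp add: funpow_step_Suc Suc.IH algebra_simps del: funpow.simps)
  qed
qed

text \<open>Put \<open>(D \<phi>) h = \<phi> (Suc h) - c (Suc h) * \<phi> h\<close> and
  \<open>(U \<psi>) h = \<psi> h + c h * \<psi> (h - 1)\<close>. The operator of \<open>e\<close> is
  \<open>U D\<close>, the other one is \<open>D U\<close>, and \<open>D\<close> intertwines their
  powers. At height \<open>0\<close> the remaining \<open>U\<close> is trivial because
  \<open>c 0 = 0\<close>; this accounts for the one step fewer.\<close>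

lemma funpow_step_contract:
  fixes c \<phi> :: "nat \<Rightarrow> 'a::comm_ring_1"
  assumes "c 0 = 0"
  defines "e \<equiv> \<lambda>n. (step (\<lambda>_. 1) (\<lambda>h. c h - c (Suc h)) (\<lambda>h. - (c h)\<^sup>2) ^^ n) \<phi>"
  shows "e (Suc n) 0 =
    (step (\<lambda>_. 1) (\<lambda>_. 0) (\<lambda>h. - 1 * (c h * c (Suc h))) ^^ n) (\<lambda>h. \<phi> (Suc h) - c (Suc h) * \<phi> h) 0"
proof -
  have e_Suc: "e (Suc n) h = e n (Suc h) + (c h - c (Suc h)) * e n h - (c h)\<^sup>2 * e n (h - 1)" for n h
    by (simp add: e_def funpow_step_Suc del: funpow.simps)
  define d where "d n = (step (\<lambda>_. 1) (\<lambda>_. 0) (\<lambda>h. - 1 * (c h * c (Suc h))) ^^ n)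
      (\<lambda>h. \<phi> (Suc h) - c (Suc h) * \<phi> h)" for n
  have d_Suc: "d (Suc n) h = d n (Suc h) - c h * c (Suc h) * d n (h - 1)" for n h
    unfolding d_def by (subst funpow_step_Suc) simp
  have "d n h = e n (Suc h) - c (Suc h) * e n h" for n h
  proof (induction n arbitrary: h)
    case 0
    then show ?case by (simp add: d_def e_def)
  next
    case (Suc n)
    show ?case
    proof (cases h)
      case 0
      then show ?thesis using assms(1)
        by (simp add: d_Suc Suc e_Suc algebra_simps power2_eq_square)
    next
      case (Suc k)
      then show ?thesis
        by (simp add: d_Suc Suc.IH e_Suc algebra_simps power2_eq_square)
    qed
  qed
  then show ?thesis using assms(1) unfolding d_def [symmetric] by (simp add: e_Suc)
qed

section \<open>Scanning a permutation\<close>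

definition pinj :: "'a set \<Rightarrow> 'b set \<Rightarrow> ('a \<times> 'b) set set" where
  "pinj A B = {R. R \<subseteq> A \<times> B \<and> single_valued R \<and> single_valued (R\<inverse>)}"

lemma finite_pinj [intro]:
  assumes "finite A" "finite B"
  shows "finite (pinj A B)"
  by (rule finite_subset[of _ "Pow (A \<times> B)"]) (use assms in \<open>auto simp: pinj_def\<close>)

lemma pinj_card:
  assumes "R \<in> pinj A B"
  shows "card (Domain R) = card R" "card (Range R) = card R"
proof -
  have "inj_on fst R" "inj_on snd R"
    using assms by (auto simp: pinj_def inj_on_def single_valued_def)
  then show "card (Domain R) = card R" "card (Range R) = card R"
    by (simp_all add: Domain_fst Range_snd card_image)
qed

lemma pinj_insert_eq:
  assumes "b \<notin> B"
  shows "pinj A (insert b B) =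
    pinj A B \<union> (\<lambda>(R, i). insert (i, b) R) ` (SIGMA R:pinj A B. A - Domain R)" (is "?l = ?r")
proof
  have "insert (i, b) R \<in> ?l" if R: "R \<in> pinj A B" and i: "i \<in> A" "i \<notin> Domain R" for R i
  proof -
    have "(i, k) \<notin> R" "(j, b) \<notin> R" for j k using R i assms by (auto simp: pinj_def)
    then show ?thesis using R i by (simp add: pinj_def single_valued_def) blast
  qed
  moreover have "pinj A B \<subseteq> ?l" by (auto simp: pinj_def)
  ultimately show "?r \<subseteq> ?l" by auto
  show "?l \<subseteq> ?r"
  proof
    fix R assume R: "R \<in> ?l"
    show "R \<in> ?r"
    proof (cases "b \<in> Range R")
      case False
      then have "R \<in> pinj A B" using R by (auto simp: pinj_def Range_iff)
      then show ?thesis ..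
    next
      case True
      then obtain i where i: "(i, b) \<in> R" by auto
      let ?S = "R - {(i, b)}"
      have "?S \<subseteq> A \<times> B" "i \<in> A" "i \<notin> Domain ?S" "single_valued ?S" "single_valued (?S\<inverse>)"
        using R i by (auto simp: pinj_def single_valued_def)
      then have "(?S, i) \<in> (SIGMA R:pinj A B. A - Domain R)" by (auto simp: pinj_def)
      then have "(\<lambda>(R, i). insert (i, b) R) (?S, i) \<in> ?r" by blast
      moreover have "insert (i, b) ?S = R" using i by auto
      ultimately show ?thesis by simp
    qed
  qed
qed

lemma sum_pinj_insert_right:
  fixes g :: "('a \<times> 'b) set \<Rightarrow> 'c::comm_monoid_add"
  assumes "finite A" "finite B" "b \<notin> B"
  shows "sum g (pinj A (insert b B)) =
    (\<Sum>R\<in>pinj A B. g R + (\<Sum>i\<in>A - Domain R. g (insert (i, b) R)))"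
proof -
  let ?I = "SIGMA R:pinj A B. A - Domain R" and ?f = "\<lambda>(R, i). insert (i, b) R"
  have nb: "(i, b) \<notin> R" if "R \<in> pinj A B" for R i
    using that assms(3) by (auto simp: pinj_def)
  have inj: "inj_on ?f ?I"
  proof (rule inj_onI, clarify)
    fix R i R' i'
    assume *: "R \<in> pinj A B" "R' \<in> pinj A B" "insert (i, b) R = insert (i', b) R'"
    then have "i = i'" using nb by blast
    then show "R = R' \<and> i = i'" using * nb by (metis insert_ident)
  qed
  have "sum g (pinj A (insert b B)) = sum g (pinj A B) + sum g (?f ` ?I)"
    unfolding pinj_insert_eq[OF assms(3)]
    by (rule sum.union_disjoint) (use assms nb in \<open>auto simp: finite_pinj\<close>)
  also have "sum g (?f ` ?I) = (\<Sum>R\<in>pinj A B. \<Sum>i\<in>A - Domain R. g (insert (i, b) R))"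
    using assms by (subst sum.reindex[OF inj]) (simp add: sum.Sigma finite_pinj case_prod_unfold)
  finally show ?thesis by (simp add: sum.distrib)
qed

lemma pinj_converse: "pinj B A = converse ` pinj A B"
proof -
  have "R\<inverse> \<in> pinj B A" if "R \<in> pinj A B" for R and A :: "'x set" and B :: "'y set"
    using that by (auto simp: pinj_def)
  then show ?thesis by (metis converse_converse image_eqI image_subsetI subsetI subset_antisym)
qed

lemma insert_converse: "(insert (a, b) R)\<inverse> = insert (b, a) (R\<inverse>)"
  by auto

lemma sum_pinj_insert_left:
  fixes g :: "('a \<times> 'b) set \<Rightarrow> 'c::comm_monoid_add"
  assumes "finite A" "finite B" "a \<notin> A"
  shows "sum g (pinj (insert a A) B) =
    (\<Sum>R\<in>pinj A B. g R + (\<Sum>j\<in>B - Range R. g (insert (a, j) R)))"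
proof -
  have inj: "inj_on converse S" for S :: "('b \<times> 'a) set set"
    by (auto simp: inj_on_def)
  have conv: "sum f (pinj X Y) = (\<Sum>R\<in>pinj Y X. f (R\<inverse>))"
    for f :: "('a \<times> 'b) set \<Rightarrow> 'c" and X Y
    unfolding pinj_converse[of X Y] sum.reindex[OF inj] by simp
  have "sum g (pinj (insert a A) B) = (\<Sum>R\<in>pinj B (insert a A). g (R\<inverse>))"
    by (rule conv)
  also have "\<dots> = (\<Sum>R\<in>pinj B A. g (R\<inverse>) + (\<Sum>j\<in>B - Domain R. g ((insert (j, a) R)\<inverse>)))"
    by (rule sum_pinj_insert_right[OF assms(2,1,3)])
  also have "\<dots> = (\<Sum>R\<in>pinj A B. g R + (\<Sum>j\<in>B - Range R. g (insert (a, j) R)))"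
    by (subst conv) (simp add: insert_converse)
  finally show ?thesis .
qed

text \<open>
  The positions, respectively values, that are unmatched when value \<open>k\<close>, respectively position \<open>i\<close>,
  is scanned; value \<open>k\<close> comes after position \<open>k\<close>.
\<close>

definition open_sources :: "(nat \<times> nat) set \<Rightarrow> nat \<Rightarrow> nat set" where
  "open_sources R k = {j\<in>{1..k}. \<forall>l<k. (j, l) \<notin> R}"

definition open_sinks :: "(nat \<times> nat) set \<Rightarrow> nat \<Rightarrow> nat set" where
  "open_sinks R i = {l\<in>{1..<i}. \<forall>j<i. (j, l) \<notin> R}"

section \<open>Weights of partial injections and their recursion\<close>

context
  fixes p q y z :: "'a::comm_ring_1"
begin

text \<open>The rank is taken among the elements open when the arc is completed, at value
  \<open>k\<close> if \<open>i \<le> k\<close> and at position \<open>i\<close> otherwise, so arcs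
  completed later do not affect it.\<close>

definition arc_wt :: "(nat \<times> nat) set \<Rightarrow> nat \<times> nat \<Rightarrow> 'a" where
  "arc_wt R = (\<lambda>(i, k).
    if i \<le> k then (if i = k then z else y) * rank_wt p q (open_sources R k) i
    else rank_wt p q (open_sinks R i) k)"

definition pinj_wt :: "(nat \<times> nat) set \<Rightarrow> 'a" where
  "pinj_wt R = prod (arc_wt R) R"

lemma pinj_wt_insert_value:
  assumes R: "R \<in> pinj {1..m} {1..n}" and m: "m \<le> Suc n" and i: "i \<in> {1..m}" "i \<notin> Domain R"
  shows "pinj_wt (insert (i, Suc n) R) =
    (if i = Suc n then z else y) * rank_wt p q ({1..Suc n} - Domain R) i * pinj_wt R"
proof -
  have fin: "finite R" using R by (auto simp: pinj_def intro: finite_subset)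
  have sub: "a \<in> {1..m} \<and> b \<in> {1..n}" if "(a, b) \<in> R" for a b using R that by (auto simp: pinj_def)
  have new: "(i, Suc n) \<notin> R" using sub by force
  have "open_sources (insert (i, Suc n) R) (Suc n) = {1..Suc n} - Domain R"
    using sub by (fastforce simp: open_sources_def Domain_iff)
  then have "arc_wt (insert (i, Suc n) R) (i, Suc n) =
      (if i = Suc n then z else y) * rank_wt p q ({1..Suc n} - Domain R) i"
    using i m by (simp add: arc_wt_def)
  \<comment> \<open>The open sources at a value \<open>b \<le> n\<close> and the open sinks at a
    position \<open>a \<le> Suc n\<close> never involve the value \<open>Suc n\<close>.\<close>
  moreover have "arc_wt (insert (i, Suc n) R) e = arc_wt R e" if "e \<in> R" for e
  proof -
    obtain a b where e: "e = (a, b)" by fastforce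
    have "open_sources (insert (i, Suc n) R) b = open_sources R b"
      "open_sinks (insert (i, Suc n) R) a = open_sinks R a"
      using sub that e m by (fastforce simp: open_sources_def open_sinks_def)+
    then show ?thesis by (simp add: arc_wt_def e)
  qed
  ultimately show ?thesis
    unfolding pinj_wt_def using fin new by (simp cong: prod.cong)
qed

text \<open>The arc ends at a smaller value, so it is neither an excedance nor a fixed point and
  carries no \<open>y\<close> or \<open>z\<close>.\<close>

lemma pinj_wt_insert_position:
  assumes R: "R \<in> pinj {1..n} {1..n}" and j: "j \<in> {1..n}" "j \<notin> Range R"
  shows "pinj_wt (insert (Suc n, j) R) = rank_wt p q ({1..n} - Range R) j * pinj_wt R"
proof -
  have fin: "finite R" using R by (auto simp: pinj_def intro: finite_subset)
  have sub: "a \<in> {1..n} \<and> b \<in> {1..n}" if "(a, b) \<in> R" for a b using R that by (auto simp: pinj_def)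
  have new: "(Suc n, j) \<notin> R" using sub by force
  have "open_sinks (insert (Suc n, j) R) (Suc n) = {1..n} - Range R"
    using sub by (fastforce simp: open_sinks_def Range_iff)
  then have "arc_wt (insert (Suc n, j) R) (Suc n, j) = rank_wt p q ({1..n} - Range R) j"
    using j by (simp add: arc_wt_def)
  moreover have "arc_wt (insert (Suc n, j) R) e = arc_wt R e" if "e \<in> R" for e
  proof -
    obtain a b where e: "e = (a, b)" by fastforce
    have "open_sources (insert (Suc n, j) R) b = open_sources R b"
      "open_sinks (insert (Suc n, j) R) a = open_sinks R a"
      using sub that e by (fastforce simp: open_sources_def open_sinks_def)+
    then show ?thesis by (simp add: arc_wt_def e)
  qed
  ultimately show ?thesis
    unfolding pinj_wt_def using fin new by (simp cong: prod.cong)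
qed

text \<open>One scanning step in dual form: the operator acts on the test function
  \<open>\<phi>\<close>. The height \<open>n - card R\<close> is the number of unmatched positions
  and also of unmatched values.\<close>

lemma sum_pinj_Suc:
  defines "L \<equiv> \<lambda>n \<phi>. \<Sum>R\<in>pinj {1..n} {1..n}. pinj_wt R * \<phi> (n - card R)"
  shows "L (Suc n) \<phi> = L n (step (\<lambda>_. 1)
    (\<lambda>h. y * q * bracket p q h + z * p ^ h + bracket p q h) (\<lambda>h. y * (bracket p q h)\<^sup>2) \<phi>)"
proof -
  let ?b = "bracket p q"
  define g where "g R = pinj_wt R * \<phi> (Suc n - card R)" for R
  \<comment> \<open>\<open>g'\<close> collects the choices for value \<open>Suc n\<close>, which is
    scanned last and therefore peeled off first.\<close>
  define g' where "g' R = g R + (\<Sum>i\<in>{1..Suc n} - Domain R. g (insert (i, Suc n) R))" for R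
  have "L (Suc n) \<phi> = (\<Sum>R\<in>pinj {1..Suc n} (insert (Suc n) {1..n}). g R)"
    unfolding L_def g_def by (simp add: atLeastAtMostSuc_conv)
  also have "\<dots> = (\<Sum>R\<in>pinj (insert (Suc n) {1..n}) {1..n}. g' R)"
    unfolding g'_def by (subst sum_pinj_insert_right) (auto simp: atLeastAtMostSuc_conv)
  also have "\<dots> = (\<Sum>R\<in>pinj {1..n} {1..n}. g' R + (\<Sum>j\<in>{1..n} - Range R. g' (insert (Suc n, j) R)))"
    by (subst sum_pinj_insert_left) auto
  also have "\<dots> = L n (step (\<lambda>_. 1) (\<lambda>h. y * q * ?b h + z * p ^ h + ?b h) (\<lambda>h. y * (?b h)\<^sup>2) \<phi>)"
    unfolding L_def
  proof (rule sum.cong[OF refl])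
    fix R assume R: "R \<in> pinj {1..n} {1..n}"
    define h where "h = n - card R"
    define S where "S = {1..n} - Domain R"
    have fin: "finite R" using R by (auto simp: pinj_def intro: finite_subset)
    have sub: "Domain R \<subseteq> {1..n}" "Range R \<subseteq> {1..n}" using R by (auto simp: pinj_def)
    have card_S: "card S = h" "card ({1..n} - Range R) = h"
      using sub pinj_card[OF R] fin by (simp_all add: S_def h_def card_Diff_subset finite_Domain finite_Range)
    have card_R: "card R = n - h" "h \<le> n"
      using card_mono[OF _ sub(1)] pinj_card[OF R] by (simp_all add: h_def)
    have fin_S: "finite S" by (simp add: S_def)
    have S_less: "i < Suc n" if "i \<in> S" for i using that by (auto simp: S_def)
    have S_Suc: "{1..Suc n} - Domain R = insert (Suc n) S" "Suc n \<notin> S" using sub by (auto simp: S_def)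
    \<comment> \<open>Position \<open>Suc n\<close> is itself open and lies above all older ones,
      hence the extra \<open>q\<close>; matching it with value \<open>Suc n\<close> gives the fixed
      point.\<close>
    have "rank_wt p q (insert (Suc n) S) i = q * rank_wt p q S i" if "i \<in> S" for i
    proof -
      have "{j \<in> insert (Suc n) S. j < i} = {j\<in>S. j < i}"
        "{j \<in> insert (Suc n) S. i < j} = insert (Suc n) {j\<in>S. i < j}"
        using S_less that by (auto dest: order.asym)
      then show ?thesis using S_Suc fin_S by (simp add: rank_wt_def algebra_simps)
    qed
    moreover have "rank_wt p q (insert (Suc n) S) (Suc n) = p ^ h"
    proof -
      have "{j \<in> insert (Suc n) S. j < Suc n} = S" "{j \<in> insert (Suc n) S. Suc n < j} = {}"
        using S_less by (auto dest: order.asym)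
      then show ?thesis unfolding rank_wt_def by (simp only:) (simp add: card_S)
    qed
    moreover have "g (insert (i, Suc n) R) =
        (if i = Suc n then z else y) * rank_wt p q (insert (Suc n) S) i * pinj_wt R * \<phi> h"
      if "i \<in> insert (Suc n) S" for i
    proof -
      have R': "R \<in> pinj {1..Suc n} {1..n}" using R by (auto simp: pinj_def)
      have "(i, Suc n) \<notin> R" using sub by force
      then have "card (insert (i, Suc n) R) = Suc (card R)" using fin by simp
      moreover have "i \<in> {1..Suc n}" "i \<notin> Domain R" using that S_Suc(1) by auto
      ultimately show ?thesis
        using pinj_wt_insert_value[OF R'] S_Suc(1) by (simp add: g_def h_def)
    qed
    ultimately have "(\<Sum>i\<in>insert (Suc n) S. g (insert (i, Suc n) R)) =
        z * p ^ h * pinj_wt R * \<phi> h + (\<Sum>i\<in>S. y * (q * rank_wt p q S i) * pinj_wt R * \<phi> h)"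
      using S_Suc(2) fin_S by (auto intro!: sum.cong)
    also have "\<dots> = (y * q * ?b h + z * p ^ h) * pinj_wt R * \<phi> h"
      using sum_rank_wt[OF fin_S, of p q] card_S
      by (simp flip: sum_distrib_left sum_distrib_right) (simp add: algebra_simps)
    \<comment> \<open>Position \<open>Suc n\<close> takes no smaller value here: leaving value
      \<open>Suc n\<close> open goes up, matching it stays level.\<close>
    finally have g'_R: "g' R = pinj_wt R * \<phi> (Suc h) + (y * q * ?b h + z * p ^ h) * pinj_wt R * \<phi> h"
      unfolding g'_def S_Suc(1) using card_R by (simp add: g_def Suc_diff_le)
    \<comment> \<open>Position \<open>Suc n\<close> takes the older value \<open>j\<close>: level if
      value \<open>Suc n\<close> stays open, down otherwise. The position is no longer open, so the
      extra \<open>q\<close> disappears.\<close>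
    have "g' (insert (Suc n, j) R) =
        rank_wt p q ({1..n} - Range R) j * (pinj_wt R * \<phi> h + y * ?b h * pinj_wt R * \<phi> (h - 1))"
      if j: "j \<in> {1..n} - Range R" for j
    proof -
      let ?R = "insert (Suc n, j) R"
      have R': "?R \<in> pinj {1..Suc n} {1..n}"
        using R j sub by (auto simp: pinj_def single_valued_def)
      have wt: "pinj_wt ?R = rank_wt p q ({1..n} - Range R) j * pinj_wt R"
        using pinj_wt_insert_position[OF R] j by simp
      have "(Suc n, j) \<notin> R" using sub by force
      then have card': "card ?R = Suc (card R)" using fin by simp
      have dom: "{1..Suc n} - Domain ?R = S" using S_Suc by auto
      have "g (insert (i, Suc n) ?R) = y * rank_wt p q S i * pinj_wt ?R * \<phi> (h - 1)" if "i \<in> S" for i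
      proof -
        have "(i, Suc n) \<notin> ?R" using sub j by force
        then have "card (insert (i, Suc n) ?R) = Suc (Suc (card R))" using fin card' by simp
        moreover have "i \<in> {1..Suc n}" "i \<notin> Domain ?R" "i \<noteq> Suc n"
          using that dom S_Suc(2) by auto
        ultimately show ?thesis
          using pinj_wt_insert_value[OF R'] dom by (simp add: g_def h_def)
      qed
      then have "(\<Sum>i\<in>S. g (insert (i, Suc n) ?R)) =
          (\<Sum>i\<in>S. y * rank_wt p q S i * pinj_wt ?R * \<phi> (h - 1))"
        by (intro sum.cong) auto
      also have "\<dots> = y * ?b h * pinj_wt ?R * \<phi> (h - 1)"
        using sum_rank_wt[OF fin_S, of p q] card_S by (simp flip: sum_distrib_left sum_distrib_right)
      finally show ?thesis
        unfolding g'_def dom using card' by (simp add: g_def wt h_def algebra_simps)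
    qed
    then have "(\<Sum>j\<in>{1..n} - Range R. g' (insert (Suc n, j) R)) =
        ?b h * (pinj_wt R * \<phi> h + y * ?b h * pinj_wt R * \<phi> (h - 1))"
      using sum_rank_wt[of "{1..n} - Range R" p q] card_S by (simp flip: sum_distrib_right)
    then show "g' R + (\<Sum>j\<in>{1..n} - Range R. g' (insert (Suc n, j) R)) =
        pinj_wt R * step (\<lambda>_. 1) (\<lambda>h. y * q * ?b h + z * p ^ h + ?b h) (\<lambda>h. y * (?b h)\<^sup>2) \<phi> (n - card R)"
      unfolding g'_R h_def [symmetric] by (simp add: step_def algebra_simps power2_eq_square)
  qed
  finally show ?thesis .
qed

end

section \<open>Permutations as complete partial injections\<close>

definition graph :: "nat \<Rightarrow> (nat \<Rightarrow> nat) \<Rightarrow> (nat \<times> nat) set" where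
  "graph n \<sigma> = (\<lambda>i. (i, \<sigma> i)) ` {1..n}"

lemma finite_perms [simp]: "finite (perms n)"
  by (simp add: perms_def finite_permutations)

lemma bij_betw_graph:
  "bij_betw (graph n) (perms n) {R \<in> pinj {1..n} {1..n}. card R = n}"
  unfolding bij_betw_def
proof
  have "\<sigma> i = \<tau> i" if "\<sigma> \<in> perms n" "\<tau> \<in> perms n" "graph n \<sigma> = graph n \<tau>" for \<sigma> \<tau> i
  proof (cases "i \<in> {1..n}")
    case True
    then have "(i, \<sigma> i) \<in> graph n \<tau>" unfolding that(3) [symmetric] by (simp add: graph_def)
    then show ?thesis by (auto simp: graph_def)
  next
    case False
    then show ?thesis using that by (simp add: perms_def permutes_not_in)
  qed
  then show "inj_on (graph n) (perms n)" by (auto simp: inj_on_def)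
  show "graph n ` perms n = {R \<in> pinj {1..n} {1..n}. card R = n}"
  proof
    show "graph n ` perms n \<subseteq> {R \<in> pinj {1..n} {1..n}. card R = n}"
    proof clarify
      fix \<sigma> assume "\<sigma> \<in> perms n"
      then have s: "\<sigma> permutes {1..n}" by (simp add: perms_def)
      then have "\<sigma> i \<in> {1..n}" if "i \<in> {1..n}" for i using that by (simp only: permutes_in_image)
      moreover have "inj \<sigma>" using s by (rule permutes_inj)
      moreover have "card (graph n \<sigma>) = n"
        unfolding graph_def by (subst card_image) (auto simp: inj_on_def)
      ultimately show "graph n \<sigma> \<in> pinj {1..n} {1..n} \<and> card (graph n \<sigma>) = n"
        by (auto simp: pinj_def graph_def single_valued_def dest: injD)
    qed
    show "{R \<in> pinj {1..n} {1..n}. card R = n} \<subseteq> graph n ` perms n"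
    proof
      fix R assume "R \<in> {R \<in> pinj {1..n} {1..n}. card R = n}"
      then have R: "R \<in> pinj {1..n} {1..n}" and n: "card R = n" by auto
      have "Domain R \<subseteq> {1..n}" using R by (auto simp: pinj_def)
      then have dom: "Domain R = {1..n}"
        by (intro card_subset_eq) (use pinj_card[OF R] n in auto)
      define \<sigma> where "\<sigma> i = (if i \<in> {1..n} then THE k. (i, k) \<in> R else i)" for i
      have iff: "(i, k) \<in> R \<longleftrightarrow> i \<in> {1..n} \<and> k = \<sigma> i" for i k
      proof -
        have "(i, \<sigma> i) \<in> R" if i: "i \<in> {1..n}"
        proof -
          have "i \<in> Domain R" unfolding dom by (rule i)
          then obtain k where "(i, k) \<in> R" by blast
          moreover from this have "(THE k. (i, k) \<in> R) = k"
            using R by (auto simp: pinj_def single_valued_def)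
          ultimately show ?thesis using i by (simp add: \<sigma>_def)
        qed
        moreover have "i \<in> {1..n}" if "(i, k) \<in> R" using R that by (auto simp: pinj_def)
        moreover have "single_valued R" using R by (simp add: pinj_def)
        ultimately show ?thesis by (blast dest: single_valuedD)
      qed
      have "inj_on \<sigma> {1..n}"
        using R iff by (auto simp: pinj_def inj_on_def single_valued_def)
      moreover have "\<sigma> i \<in> {1..n}" if "i \<in> {1..n}" for i
      proof -
        have "(i, \<sigma> i) \<in> R" using iff that by blast
        then show ?thesis using R by (auto simp: pinj_def)
      qed
      ultimately have "bij_betw \<sigma> {1..n} {1..n}"
        unfolding bij_betw_def by (intro conjI endo_inj_surj) auto
      moreover have "\<sigma> i = i" if "i \<notin> {1..n}" for i
        using that unfolding \<sigma>_def by (rule if_not_P)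
      ultimately have "\<sigma> \<in> perms n" unfolding perms_def by (blast intro: bij_imp_permutes)
      moreover have "R = graph n \<sigma>" using iff by (auto simp: graph_def)
      ultimately show "R \<in> graph n ` perms n" by blast
    qed
  qed
qed

text \<open>A nesting is charged to its inner arc, which the scan completes first; the outer arc
  then starts or ends at an open element of smaller rank.\<close>

lemma nest_eq_sum:
  "nest n \<sigma> = (\<Sum>j=1..n. card {i\<in>{1..n}. (i < j \<and> j \<le> \<sigma> j \<and> \<sigma> j < \<sigma> i) \<or> (i > j \<and> j > \<sigma> j \<and> \<sigma> j > \<sigma> i)})"
proof -
  have "nest n \<sigma> = card ((\<lambda>(j, i). (i, j)) ` (SIGMA j:{1..n}. {i\<in>{1..n}.
      (i < j \<and> j \<le> \<sigma> j \<and> \<sigma> j < \<sigma> i) \<or> (i > j \<and> j > \<sigma> j \<and> \<sigma> j > \<sigma> i)}))"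
    unfolding nest_def by (rule arg_cong[where f = card]) auto
  also have "\<dots> = card (SIGMA j:{1..n}. {i\<in>{1..n}.
      (i < j \<and> j \<le> \<sigma> j \<and> \<sigma> j < \<sigma> i) \<or> (i > j \<and> j > \<sigma> j \<and> \<sigma> j > \<sigma> i)})"
    by (rule card_image) (auto simp: inj_on_def)
  finally show ?thesis by simp
qed

text \<open>
  A crossing is charged to the arc that a scan of \<open>1, \<dots>, n\<close> completes first: for upper arcs the one
  starting at the left, for lower arcs the one starting at \<open>j\<close> in the notation of \<^const>\<open>cros\<close>.
\<close>

lemma cros_eq_sum:
  "cros n \<sigma> = (\<Sum>i=1..n. card {j\<in>{1..n}. (i < j \<and> j \<le> \<sigma> i \<and> \<sigma> i < \<sigma> j) \<or> (j > i \<and> i > \<sigma> j \<and> \<sigma> j > \<sigma> i)})"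
proof -
  let ?U = "\<lambda>i. {j\<in>{1..n}. i < j \<and> j \<le> \<sigma> i \<and> \<sigma> i < \<sigma> j}"
  let ?D = "\<lambda>i. {j\<in>{1..n}. j > i \<and> i > \<sigma> j \<and> \<sigma> j > \<sigma> i}"
  have "cros n \<sigma> = card ((SIGMA i:{1..n}. ?U i) \<union> (\<lambda>(j, i). (i, j)) ` (SIGMA i:{1..n}. ?D i))"
    unfolding cros_def by (rule arg_cong[where f = card]) auto
  also have "\<dots> = card (SIGMA i:{1..n}. ?U i) + card ((\<lambda>(j, i). (i, j)) ` (SIGMA i:{1..n}. ?D i))"
    by (rule card_Un_disjoint) auto
  also have "card ((\<lambda>(j, i). (i, j)) ` (SIGMA i:{1..n}. ?D i)) = card (SIGMA i:{1..n}. ?D i)"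
    by (rule card_image) (auto simp: inj_on_def)
  also have "card (SIGMA i:{1..n}. ?U i) + \<dots> = (\<Sum>i=1..n. card (?U i) + card (?D i))"
    by (simp add: sum.distrib)
  also have "\<dots> = (\<Sum>i=1..n. card {j\<in>{1..n}. (i < j \<and> j \<le> \<sigma> i \<and> \<sigma> i < \<sigma> j) \<or> (j > i \<and> i > \<sigma> j \<and> \<sigma> j > \<sigma> i)})"
  proof (rule sum.cong[OF refl])
    fix i
    have "card (?U i) + card (?D i) = card (?U i \<union> ?D i)"
      by (rule card_Un_disjoint [symmetric]) auto
    also have "?U i \<union> ?D i = {j\<in>{1..n}. (i < j \<and> j \<le> \<sigma> i \<and> \<sigma> i < \<sigma> j) \<or> (j > i \<and> i > \<sigma> j \<and> \<sigma> j > \<sigma> i)}"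
      by auto
    finally show "card (?U i) + card (?D i) = card {j\<in>{1..n}. (i < j \<and> j \<le> \<sigma> i \<and> \<sigma> i < \<sigma> j) \<or> (j > i \<and> i > \<sigma> j \<and> \<sigma> j > \<sigma> i)}" .
  qed
  finally show ?thesis .
qed

text \<open>When an arc is completed, the open elements of smaller rank belong to the arcs nesting
  it, those of larger rank to the crossings charged to it.\<close>

lemma pinj_wt_graph:
  fixes p q y z :: "'a::comm_ring_1"
  assumes "\<sigma> \<in> perms n"
  shows "pinj_wt p q y z (graph n \<sigma>) =
    (\<Prod>i=1..n. if i < \<sigma> i then y else if i = \<sigma> i then z else 1) * p ^ nest n \<sigma> * q ^ cros n \<sigma>"
proof -
  let ?N = "\<lambda>j. {i\<in>{1..n}. (i < j \<and> j \<le> \<sigma> j \<and> \<sigma> j < \<sigma> i) \<or> (i > j \<and> j > \<sigma> j \<and> \<sigma> j > \<sigma> i)}"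
  let ?C = "\<lambda>i. {j\<in>{1..n}. (i < j \<and> j \<le> \<sigma> i \<and> \<sigma> i < \<sigma> j) \<or> (j > i \<and> i > \<sigma> j \<and> \<sigma> j > \<sigma> i)}"
  have s: "\<sigma> permutes {1..n}" using assms by (simp add: perms_def)
  have range: "\<sigma> i \<in> {1..n} \<longleftrightarrow> i \<in> {1..n}" for i using s by (rule permutes_in_image)
  have inj: "\<sigma> i = \<sigma> j \<longleftrightarrow> i = j" for i j using s by (metis permutes_inj injD)
  \<comment> \<open>The values below \<open>i\<close> not taken before position \<open>i\<close> are
    taken at \<open>i\<close> or later; pulling them back along \<open>\<sigma>\<close> turns ranks
    of values into counts of positions.\<close>
  have sinks: "{l \<in> open_sinks (graph n \<sigma>) i. P l} = \<sigma> ` {j\<in>{1..n}. j \<ge> i \<and> \<sigma> j < i \<and> P (\<sigma> j)}"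
    if "i \<in> {1..n}" for i P
  proof safe
    fix l assume l: "l \<in> open_sinks (graph n \<sigma>) i" "P l"
    then have "l \<in> {1..n}" using that by (auto simp: open_sinks_def)
    then obtain j where j: "l = \<sigma> j" using s by (metis permutes_surj surj_def)
    then have "j \<in> {1..n}" using \<open>l \<in> {1..n}\<close> range by simp
    then show "l \<in> \<sigma> ` {j \<in> {1..n}. i \<le> j \<and> \<sigma> j < i \<and> P (\<sigma> j)}"
      using l j by (auto simp: open_sinks_def graph_def not_less[symmetric])
  next
    fix j assume j: "j \<in> {1..n}" "i \<le> j" "\<sigma> j < i" "P (\<sigma> j)"
    then show "\<sigma> j \<in> open_sinks (graph n \<sigma>) i"
      using range[of j] by (auto simp: open_sinks_def graph_def inj)
  qed
  have arc: "arc_wt p q y z (graph n \<sigma>) (i, \<sigma> i) =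
      (if i < \<sigma> i then y else if i = \<sigma> i then z else 1) * (p ^ card (?N i) * q ^ card (?C i))"
    if i: "i \<in> {1..n}" for i
  proof (cases "i \<le> \<sigma> i")
    case True
    have src: "j \<in> open_sources (graph n \<sigma>) (\<sigma> i) \<longleftrightarrow> j \<in> {1..\<sigma> i} \<and> \<sigma> i \<le> \<sigma> j" for j
      using range[of i] i by (auto simp: open_sources_def graph_def not_less)
    have "{j \<in> open_sources (graph n \<sigma>) (\<sigma> i). j < i} = ?N i"
      "{j \<in> open_sources (graph n \<sigma>) (\<sigma> i). i < j} = ?C i"
      unfolding src using True range[of i] i inj by (auto simp: order_le_less)
    then show ?thesis using True by (simp add: arc_wt_def rank_wt_def)
  next
    case False
    have inj': "inj_on \<sigma> S" for S using inj by (auto simp: inj_on_def)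
    have "{l \<in> open_sinks (graph n \<sigma>) i. l < \<sigma> i} = \<sigma> ` ?N i"
      "{l \<in> open_sinks (graph n \<sigma>) i. \<sigma> i < l} = \<sigma> ` ?C i"
      unfolding sinks[OF i] using False by (auto simp: order_le_less intro!: arg_cong[where f = "(`) \<sigma>"])
    then show ?thesis using False by (simp add: arc_wt_def rank_wt_def card_image[OF inj'])
  qed
  have "pinj_wt p q y z (graph n \<sigma>) = (\<Prod>i=1..n. arc_wt p q y z (graph n \<sigma>) (i, \<sigma> i))"
    unfolding pinj_wt_def by (subst (2) graph_def, subst prod.reindex) (auto simp: inj_on_def)
  also have "\<dots> = (\<Prod>i=1..n. (if i < \<sigma> i then y else if i = \<sigma> i then z else 1) *
      (p ^ card (?N i) * q ^ card (?C i)))"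
    by (rule prod.cong) (use arc in auto)
  finally show ?thesis
    by (simp add: prod.distrib power_sum nest_eq_sum cros_eq_sum mult.assoc)
qed

text \<open>The test function \<open>of_bool (h = 0)\<close> keeps only the partial injections
  without unmatched elements.\<close>

lemma sum_perms_eq_step:
  fixes p q y z :: "'a::comm_ring_1"
  shows "(\<Sum>\<sigma>\<in>perms n. (\<Prod>i=1..n. if i < \<sigma> i then y else if i = \<sigma> i then z else 1) *
      p ^ nest n \<sigma> * q ^ cros n \<sigma>) =
    (step (\<lambda>_. 1) (\<lambda>h. y * q * bracket p q h + z * p ^ h + bracket p q h)
      (\<lambda>h. y * (bracket p q h)\<^sup>2) ^^ n) (\<lambda>h. of_bool (h = 0)) 0"
proof -
  let ?T = "step (\<lambda>_. 1) (\<lambda>h. y * q * bracket p q h + z * p ^ h + bracket p q h)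
      (\<lambda>h. y * (bracket p q h)\<^sup>2)"
  have L: "(\<Sum>R\<in>pinj {1..m} {1..m}. pinj_wt p q y z R * \<phi> (m - card R)) = (?T ^^ m) \<phi> 0" for m \<phi>
  proof (induction m arbitrary: \<phi>)
    case 0
    have "pinj {1..0::nat} {1..0::nat} = {{}}" by (auto simp: pinj_def)
    then show ?case by (simp add: pinj_wt_def)
  next
    case (Suc m)
    show ?case unfolding sum_pinj_Suc Suc.IH by (simp only: funpow_Suc_right comp_apply)
  qed
  \<comment> \<open>Excludes that \<open>n - card R = 0\<close> holds merely by truncation.\<close>
  have "card R \<le> n" if "R \<in> pinj {1..n} {1..n}" for R :: "(nat \<times> nat) set"
    using that pinj_card[OF that] card_mono[of "{1..n}" "Domain R"] by (auto simp: pinj_def)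
  then have "(\<Sum>R\<in>pinj {1..n} {1..n}. pinj_wt p q y z R * of_bool (n - card R = 0)) =
      (\<Sum>R\<in>{R \<in> pinj {1..n} {1..n}. card R = n}. pinj_wt p q y z R)"
    by (intro sum.mono_neutral_cong_right) (auto simp: finite_pinj le_antisym)
  also have "\<dots> = (\<Sum>\<sigma>\<in>perms n. pinj_wt p q y z (graph n \<sigma>))"
    by (rule sum.reindex_bij_betw [OF bij_betw_graph, symmetric])
  finally show ?thesis using L[where m = n and \<phi> = "\<lambda>h. of_bool (h = 0)"] by (simp add: pinj_wt_graph)
qed

section \<open>Building an alternating permutation from its largest letter\<close>

fun alt :: "bool \<Rightarrow> nat list \<Rightarrow> bool" where
  "alt b (x # y # xs) \<longleftrightarrow> (if b then x < y else y < x) \<and> alt (\<not> b) (y # xs)"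
| "alt b xs \<longleftrightarrow> True"

fun adj :: "(nat \<Rightarrow> nat \<Rightarrow> bool) \<Rightarrow> nat list \<Rightarrow> nat" where
  "adj P (x # y # xs) = of_bool (P x y) + adj P (y # xs)"
| "adj P xs = 0"

text \<open>
  With \<open>asc\<close> and \<open>des\<close> below, \<open>pat asc\<close> counts the pattern 2-13 and \<open>pat des\<close> the pattern 2-31;
  the count of 31-2 in \<open>u\<close> is \<open>pat asc (rev u)\<close>.
\<close>

fun pat :: "(nat \<Rightarrow> nat \<Rightarrow> nat \<Rightarrow> bool) \<Rightarrow> nat list \<Rightarrow> nat" where
  "pat Q [] = 0"
| "pat Q (x # xs) = adj (Q x) xs + pat Q xs"

definition asc :: "nat \<Rightarrow> nat \<Rightarrow> nat \<Rightarrow> bool" where "asc v a b \<longleftrightarrow> a < v \<and> v < b"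
definition des :: "nat \<Rightarrow> nat \<Rightarrow> nat \<Rightarrow> bool" where "des v a b \<longleftrightarrow> b < v \<and> v < a"

abbreviation zeros :: "nat list \<Rightarrow> nat" where "zeros xs \<equiv> count_list xs 0"

section \<open>Adjacent pairs and patterns in words with unfilled valleys\<close>

lemma alt_append: "alt b (xs @ z # ys) \<longleftrightarrow> alt b (xs @ [z]) \<and> alt (b = even (length xs)) (z # ys)"
proof (induction xs arbitrary: b)
  case (Cons x xs)
  have [simp]: "(\<not> b) = even k \<longleftrightarrow> b = odd k" for k :: nat by auto
  show ?case using Cons by (cases xs) auto
qed simp

lemma alt_snocD: "alt b (xs @ [a]) \<Longrightarrow> alt b xs"
proof (induction xs arbitrary: b)
  case (Cons x xs)
  then show ?case by (cases xs) auto
qed simp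

lemma adj_append: "adj P (xs @ z # ys) = adj P (xs @ [z]) + adj P (z # ys)"
proof (induction xs)
  case (Cons x xs)
  then show ?case by (cases xs) auto
qed simp

lemma adj_snoc2: "adj P (xs @ [a, b]) = adj P (xs @ [a]) + of_bool (P a b)"
  using adj_append[of P xs a "[b]"] by simp

lemma adj_rev: "adj P (rev xs) = adj (\<lambda>a b. P b a) xs"
proof (induction xs)
  case (Cons x xs)
  then show ?case by (cases xs) (simp_all add: adj_snoc2)
qed simp

lemma adj_asc_rev: "adj (asc v) (rev xs) = adj (des v) xs"
proof -
  have "(\<lambda>a b. asc v b a) = des v" by (auto simp: asc_def des_def fun_eq_iff)
  then show ?thesis by (simp add: adj_rev)
qed

lemma adj_eq_0:
  assumes "\<And>a b. a \<in> set xs \<Longrightarrow> b \<in> set xs \<Longrightarrow> \<not> P a b"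
  shows "adj P xs = 0"
  using assms by (induction P xs rule: adj.induct) auto

text \<open>Strict alternation keeps zeros apart, so the neighbours of a \<open>0\<close> exceed
  \<open>v\<close>: every \<open>0\<close> after the first letter is entered by a descent across
  \<open>v\<close>, and no other step falls across \<open>v\<close>.\<close>

lemma adj_des_eq_zeros:
  assumes "alt b (a # t)" "\<forall>x\<in>set (a # t). x = 0 \<or> v < x" "v > 0"
  shows "adj (des v) (a # t) = zeros t"
  using assms
proof (induction t arbitrary: a b)
  case (Cons c t)
  have "adj (des v) (c # t) = zeros t" using Cons.prems by (intro Cons.IH[of "\<not> b"]) auto
  moreover have "des v a c \<longleftrightarrow> c = 0" using Cons.prems by (auto simp: des_def split: if_splits)
  ultimately show ?case by simp
qed simp

text \<open>Dually, every \<open>0\<close> except a final one is left by an ascent across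
  \<open>v\<close>.\<close>

lemma adj_asc_eq_zeros:
  assumes "alt b (a # t)" "\<forall>x\<in>set (a # t). x = 0 \<or> v < x" "v > 0"
  shows "adj (asc v) (a # t) = zeros (butlast (a # t))"
  using assms
proof (induction t arbitrary: a b)
  case (Cons c t)
  have "adj (asc v) (c # t) = zeros (butlast (c # t))"
    using Cons.prems by (intro Cons.IH[of "\<not> b"]) auto
  moreover have "asc v a c \<longleftrightarrow> a = 0" using Cons.prems by (auto simp: asc_def split: if_splits)
  ultimately show ?case by simp
qed simp

text \<open>For \<open>w > v\<close> the letters \<open>v\<close> and \<open>0\<close> lie on the
  same side of \<open>w\<close>; for \<open>w = 0\<close> no letter lies below
  \<open>w\<close>.\<close>

lemma adj_replace:
  assumes "Q = asc \<or> Q = des" "w = 0 \<or> v < w"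
  shows "adj (Q w) (x @ v # y) = adj (Q w) (x @ 0 # y)"
proof (induction x)
  case Nil
  show ?case using assms by (cases y) (auto simp: asc_def des_def)
next
  case (Cons a x)
  then show ?case using assms by (cases x) (auto simp: asc_def des_def)
qed

lemma adj_insert:
  assumes "Q = asc \<or> Q = des" "w = 0 \<or> v < w"
  shows "adj (Q w) (x @ 0 # v # 0 # y) = adj (Q w) (x @ 0 # y)"
proof -
  have "\<not> Q w 0 v" "\<not> Q w v 0" using assms by (auto simp: asc_def des_def)
  then have "adj (Q w) (0 # v # 0 # y) = adj (Q w) (0 # y)" by simp
  then show ?thesis using adj_append[of "Q w" x 0 "v # 0 # y"] adj_append[of "Q w" x 0 y] by simp
qed

lemma adj_0: "Q = asc \<or> Q = des \<Longrightarrow> adj (Q 0) xs = 0"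
  by (rule adj_eq_0) (auto simp: asc_def des_def)

text \<open>Letters before \<open>v\<close> cannot tell \<open>v\<close> from \<open>0\<close>, so
  new occurrences have \<open>v\<close> itself as the letter 2, a role that \<open>0\<close> never
  plays.\<close>

lemma pat_replace:
  assumes "Q = asc \<or> Q = des" "\<forall>w\<in>set x. w = 0 \<or> v < w"
  shows "pat Q (x @ v # y) = pat Q (x @ 0 # y) + adj (Q v) y"
  using assms(2)
proof (induction x)
  case Nil
  show ?case using assms(1) by (simp add: adj_0)
next
  case (Cons w x)
  then show ?case using adj_replace[OF assms(1), of w v x y] by simp
qed

text \<open>The added pairs straddle no earlier letter, and the zeros around \<open>v\<close> never
  act as the letter 2; only \<open>v\<close> adds occurrences.\<close>

lemma pat_insert:
  assumes "Q = asc \<or> Q = des" "\<forall>w\<in>set x. w = 0 \<or> v < w"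
  shows "pat Q (x @ 0 # v # 0 # y) = pat Q (x @ 0 # y) + adj (Q v) (0 # y)"
  using assms(2)
proof (induction x)
  case Nil
  have "\<not> Q v v 0" "\<not> Q v 0 v" "\<not> Q 0 v 0" "\<not> Q 0 0 v" using assms(1) by (auto simp: asc_def des_def)
  then show ?case using assms(1) by (simp add: adj_0)
next
  case (Cons w x)
  then show ?case using adj_insert[OF assms(1), of w v x y] by simp
qed

text \<open>
  The letters \<open>0\<close> are the valleys not yet filled: they separate the blocks. A leading \<open>0\<close> is added,
  and at the end either a \<open>0\<close> (\<open>n\<close> odd) or a letter \<open>e\<close> larger than all others (\<open>n\<close> even).
\<close>

definition words :: "nat \<Rightarrow> nat set \<Rightarrow> nat list set" where
  "words e V = {u. u \<noteq> [] \<and> hd u = 0 \<and> last u = e \<and> alt True u \<and>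
    filter_mset (\<lambda>x. 0 < x) (mset u) = mset_set V}"

definition splits :: "nat list \<Rightarrow> (nat list \<times> nat list) set" where
  "splits u = {(x, y). u = x @ 0 # y}"

lemma set_words:
  assumes "u \<in> words e V" "finite V"
  shows "set u \<subseteq> insert 0 V"
proof
  fix a assume a: "a \<in> set u"
  have eq: "filter_mset (\<lambda>x. 0 < x) (mset u) = mset_set V" using assms(1) by (simp add: words_def)
  have "a \<in># mset_set V" if "a \<noteq> 0" unfolding eq [symmetric] using a that by simp
  then show "a \<in> insert 0 V" using assms(2) by auto
qed

lemma finite_splits [simp]: "finite (splits u)"
proof (rule finite_subset)
  show "splits u \<subseteq> (\<lambda>i. (take i u, drop (Suc i) u)) ` {..<length u}"
  proof clarify
    fix x y assume "(x, y) \<in> splits u"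
    then have "u = x @ 0 # y" by (simp add: splits_def)
    then show "(x, y) \<in> (\<lambda>i. (take i u, drop (Suc i) u)) ` {..<length u}"
      by (intro image_eqI[of _ _ "length x"]) auto
  qed
qed simp

lemma finite_filter_splits [simp]: "finite {(x, y). (x, y) \<in> splits u \<and> P x y}"
  by (rule finite_subset[OF _ finite_splits[of u]]) auto

lemma splitsD: "(x, y) \<in> splits u \<Longrightarrow> u = x @ 0 # y"
  by (simp add: splits_def)

lemma splits_Nil [simp]: "splits [] = {}"
  by (simp add: splits_def)

lemma splits_Cons:
  "splits (a # t) = (if a = 0 then {([], t)} else {}) \<union> (\<lambda>(x, y). (a # x, y)) ` splits t"
  by (auto simp: splits_def Cons_eq_append_conv)

lemma splits_snoc_nonempty:
  "{(x, y) \<in> splits (t @ [a]). y \<noteq> []} = (\<lambda>(x, y). (x, y @ [a])) ` splits t"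
proof
  show "{(x, y) \<in> splits (t @ [a]). y \<noteq> []} \<subseteq> (\<lambda>(x, y). (x, y @ [a])) ` splits t"
  proof clarify
    fix x y assume *: "(x, y) \<in> splits (t @ [a])" "y \<noteq> []"
    then obtain y' b where y: "y = y' @ [b]" by (cases y rule: rev_cases) auto
    then have "t @ [a] = (x @ 0 # y') @ [b]" using * by (simp add: splits_def)
    then have "t = x @ 0 # y'" "a = b" by (simp_all only: append1_eq_conv)
    then show "(x, y) \<in> (\<lambda>(x, y). (x, y @ [a])) ` splits t"
      using y by (auto simp: splits_def)
  qed
qed (auto simp: splits_def)

text \<open>Prepending a \<open>0\<close> adds one split with nothing on its left and puts a factor
  \<open>q\<close> on all others, as in the recursion of \<open>bracket\<close>.\<close>

lemma sum_splits:
  "(\<Sum>(x, y)\<in>splits u. p ^ zeros y * q ^ zeros x) = bracket p q (zeros u)"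
proof (induction u)
  case (Cons a t)
  have inj: "inj_on (\<lambda>(x, y). (a # x, y)) (splits t)" by (auto simp: inj_on_def)
  have "(\<Sum>(x, y)\<in>splits (a # t). p ^ zeros y * q ^ zeros x) =
      (if a = 0 then p ^ zeros t else 0) + (\<Sum>(x, y)\<in>splits t. p ^ zeros y * q ^ zeros (a # x))"
    unfolding splits_Cons
    by (subst sum.union_disjoint; (subst sum.reindex[OF inj])?) (auto simp: case_prod_unfold)
  also have "(\<Sum>(x, y)\<in>splits t. p ^ zeros y * q ^ zeros (a # x)) =
      (if a = 0 then q else 1) * (\<Sum>(x, y)\<in>splits t. p ^ zeros y * q ^ zeros x)"
    by (auto simp: sum_distrib_left case_prod_unfold algebra_simps intro!: sum.cong)
  finally show ?case using Cons by (simp add: add.commute)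
qed simp

lemma splits_Cons_nonempty: "{(x, y) \<in> splits (a # t). x \<noteq> []} = (\<lambda>(x, y). (a # x, y)) ` splits t"
  by (auto simp: splits_Cons)

text \<open>A step into \<open>0\<close> must be a descent, and in a word starting with an ascent
  descents lead to even indices.\<close>

lemma even_length_split:
  assumes "alt True (x @ 0 # y)"
  shows "even (length x)"
proof (cases x rule: rev_cases)
  case (snoc x' a)
  then have "alt True (x' @ a # 0 # y)" using assms by simp
  then show ?thesis by (subst (asm) alt_append) (simp add: snoc split: if_splits)
qed simp

text \<open>At an odd index the new smallest letter is a peak, so both neighbours are
  \<open>0\<close> and it opens a block; at an even index it is a valley replacing a
  \<open>0\<close> and joins two blocks. The end letters must survive, which excludes
  \<open>x = []\<close> and \<open>y = []\<close> in the second case.\<close>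

lemma words_insert:
  assumes V: "finite V" "v > 0" "\<forall>x\<in>V. v < x" and e: "e = 0 \<or> e \<in> V"
  defines "Z \<equiv> {(x, y). x @ 0 # y \<in> words e V}"
  shows "words e (insert v V) = (\<lambda>(x, y). x @ 0 # v # 0 # y) ` Z \<union>
    (\<lambda>(x, y). x @ v # y) ` {(x, y) \<in> Z. x \<noteq> [] \<and> y \<noteq> []}" (is "?l = ?r")
proof
  have v: "v \<notin> V" using V by auto
  show "?r \<subseteq> ?l"
  proof -
    have "x @ 0 # v # 0 # y \<in> ?l" "x \<noteq> [] \<Longrightarrow> y \<noteq> [] \<Longrightarrow> x @ v # y \<in> ?l"
      if u: "x @ 0 # y \<in> words e V" for x y
    proof -
      have even: "even (length x)" using u even_length_split by (auto simp: words_def)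
      have "alt True (x @ 0 # y)" using u by (simp add: words_def)
      then have alt: "alt True (x @ [0])" "alt True (0 # y)"
        using even alt_append[of True x 0 y] by auto
      have set: "\<forall>a\<in>set x \<union> set y. a = 0 \<or> v < a" using set_words[OF u V(1)] V(3) by auto
      have "alt True (x @ 0 # v # 0 # y)"
        using alt even V(2) alt_append[of True x 0 "v # 0 # y"] by auto
      then show "x @ 0 # v # 0 # y \<in> ?l"
        using u V v by (auto simp: words_def hd_append)
      assume ne: "x \<noteq> []" "y \<noteq> []"
      obtain x' a where x: "x = x' @ [a]" using ne by (cases x rule: rev_cases) auto
      obtain b y' where y: "y = b # y'" using ne by (cases y) auto
      have "odd (length x')" using even x by simp
      then have a: "0 < a" "alt True (x' @ [a])"
        using alt(1) alt_append[of True x' a "[0]"] x by auto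
      have b: "0 < b" "alt False (b # y')" using alt(2) y by auto
      have "alt True (x @ v # y)"
        using a b set x y \<open>odd (length x')\<close> even
          alt_append[of True x v y] alt_append[of True x' a "[v]"] by auto
      then show "x @ v # y \<in> ?l"
        using u ne V v by (auto simp: words_def hd_append)
    qed
    then show ?thesis by (auto simp: Z_def)
  qed
  show "?l \<subseteq> ?r"
  proof
    fix u assume u: "u \<in> ?l"
    have mset: "filter_mset (\<lambda>x. 0 < x) (mset u) = add_mset v (mset_set V)"
      using u V v by (simp add: words_def)
    then have "v \<in># filter_mset (\<lambda>x. 0 < x) (mset u)" by simp
    then have "v \<in> set u" by auto
    then obtain x y where xy: "u = x @ v # y" by (auto dest: split_list)
    have set: "set u \<subseteq> insert 0 (insert v V)" using set_words[OF u] V(1) by simp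
    have mset': "filter_mset (\<lambda>x. 0 < x) (mset (x @ y)) = mset_set V"
      using mset V(2) by (simp add: xy)
    have vxy: "v \<notin> set (x @ y)"
    proof
      assume "v \<in> set (x @ y)"
      then have "v \<in># mset_set V" unfolding mset' [symmetric] using V(2) by simp
      then show False using V(1) v by simp
    qed
    \<comment> \<open>\<open>v\<close> differs from the first letter \<open>0\<close> and from the
      last letter \<open>e\<close>.\<close>
    have ne: "x \<noteq> []" "y \<noteq> []"
      using u V(2) e v by (auto simp: words_def xy)
    obtain x' a where x: "x = x' @ [a]" using ne by (cases x rule: rev_cases) auto
    obtain b y' where y: "y = b # y'" using ne by (cases y) auto
    have ab: "a = 0 \<or> v < a" "b = 0 \<or> v < b" using set vxy V(3) by (auto simp: xy x y)
    have alt: "alt True u" using u by (simp add: words_def)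
    then have alt': "alt True (x @ [v])" "alt (even (length x)) (v # b # y')"
      using alt_append[of True x v y] by (auto simp: xy y)
    then have alt'': "alt True (x' @ [a])" "alt (even (length x')) [a, v]"
      using alt_append[of True x' a "[v]"] by (auto simp: x)
    show "u \<in> ?r"
    proof (cases "even (length x)")
      case True
      then have "v < a" "v < b" using alt'' alt' x ab by (auto split: if_splits)
      then have "alt True (x @ 0 # y)"
        using True alt' alt'' alt_append[of True x 0 y] alt_append[of True x' a "[0]"] by (auto simp: x y)
      then have "x @ 0 # y \<in> words e V"
        using u ne mset' by (auto simp: words_def xy)
      then show ?thesis using ne by (auto simp: xy Z_def)
    next
      case False
      then have ab0: "a = 0" "b = 0" using alt'' alt' x ab by (auto split: if_splits)
      then have "alt True (x' @ 0 # y')"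
        using False alt' alt'' alt_append[of True x' 0 y'] by (auto simp: x)
      then have "x' @ 0 # y' \<in> words e V"
        using u mset' by (auto simp: words_def xy x y ab0 hd_append split: if_splits)
      then have "(x', y') \<in> Z" by (simp add: Z_def)
      moreover have "u = x' @ 0 # v # 0 # y'" by (simp add: xy x y ab0)
      ultimately show ?thesis by force
    qed
  qed
qed

text \<open>The position of \<open>v\<close> determines the split, since \<open>v\<close> is new;
  the parity of that position separates the two kinds of words.\<close>

lemma sum_words_insert:
  assumes V: "finite V" "v > 0" "\<forall>x\<in>V. v < x" and e: "e = 0 \<or> e \<in> V"
    and fin: "finite (words e V)"
  shows "finite (words e (insert v V))"
    "sum g (words e (insert v V)) =
      (\<Sum>u\<in>words e V. (\<Sum>(x, y)\<in>splits u. g (x @ 0 # v # 0 # y)) +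
        (\<Sum>(x, y)\<in>{(x, y)\<in>splits u. x \<noteq> [] \<and> y \<noteq> []}. g (x @ v # y)))"
proof -
  define Z where "Z = {(x, y). x @ 0 # y \<in> words e V}"
  define Z' where "Z' = {(x, y) \<in> Z. x \<noteq> [] \<and> y \<noteq> []}"
  have Z_eq: "Z = (\<Union>u\<in>words e V. splits u)"
    "Z' = (\<Union>u\<in>words e V. {(x, y)\<in>splits u. x \<noteq> [] \<and> y \<noteq> []})"
    by (auto simp: Z'_def Z_def splits_def)
  have fin_Z: "finite Z" using fin unfolding Z_eq by simp
  then have fin_Z': "finite Z'" unfolding Z'_def by (rule rev_finite_subset) auto
  have words: "words e (insert v V) = (\<lambda>(x, y). x @ 0 # v # 0 # y) ` Z \<union> (\<lambda>(x, y). x @ v # y) ` Z'"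
    unfolding Z_def Z'_def by (rule words_insert[OF V e])
  show "finite (words e (insert v V))" unfolding words using fin_Z fin_Z' by simp
  have nv: "v \<notin> set x" "v \<notin> set y" "even (length x)" if "(x, y) \<in> Z" for x y
    using that V set_words[of "x @ 0 # y" e V] even_length_split[of x y]
    by (auto simp: Z_def words_def)
  have inj: "inj_on (\<lambda>(x, y). x @ 0 # v # 0 # y) Z"
  proof (rule inj_onI, clarify)
    fix x y x' y' assume *: "(x, y) \<in> Z" "(x', y') \<in> Z" "x @ 0 # v # 0 # y = x' @ 0 # v # 0 # y'"
    then have "(x @ [0]) @ v # 0 # y = (x' @ [0]) @ v # 0 # y'" by simp
    then show "x = x' \<and> y = y'"
      using nv[OF *(1)] V(2) by (subst (asm) append_Cons_eq_iff) auto
  qed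
  have inj': "inj_on (\<lambda>(x, y). x @ v # y) Z'"
  proof (rule inj_onI, clarify)
    fix x y x' y' assume *: "(x, y) \<in> Z'" "(x', y') \<in> Z'" "x @ v # y = x' @ v # y'"
    then show "x = x' \<and> y = y'"
      using nv[of x y] V(2) by (subst (asm) append_Cons_eq_iff) (auto simp: Z'_def)
  qed
  have "x @ 0 # v # 0 # y \<noteq> x' @ v # y'" if "(x, y) \<in> Z" "(x', y') \<in> Z'" for x y x' y'
  proof
    assume "x @ 0 # v # 0 # y = x' @ v # y'"
    then have "(x @ [0]) @ v # 0 # y = x' @ v # y'" by simp
    then have "x @ [0] = x'"
      using nv[OF that(1)] V(2) by (subst (asm) append_Cons_eq_iff) auto
    then show False using nv(3)[OF that(1)] nv(3)[of x' y'] that(2) by (auto simp: Z'_def)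
  qed
  then have "sum g (words e (insert v V)) =
      sum g ((\<lambda>(x, y). x @ 0 # v # 0 # y) ` Z) + sum g ((\<lambda>(x, y). x @ v # y) ` Z')"
    unfolding words using fin_Z fin_Z' by (intro sum.union_disjoint) auto
  also have "\<dots> = (\<Sum>(x, y)\<in>Z. g (x @ 0 # v # 0 # y)) + (\<Sum>(x, y)\<in>Z'. g (x @ v # y))"
    unfolding sum.reindex[OF inj] sum.reindex[OF inj'] by (simp add: case_prod_unfold)
  also have "(\<Sum>(x, y)\<in>Z. g (x @ 0 # v # 0 # y)) =
      (\<Sum>u\<in>words e V. \<Sum>(x, y)\<in>splits u. g (x @ 0 # v # 0 # y))"
    unfolding Z_eq by (rule sum.UNION_disjoint) (use fin in \<open>auto dest: splitsD\<close>)
  also have "(\<Sum>(x, y)\<in>Z'. g (x @ v # y)) =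
      (\<Sum>u\<in>words e V. \<Sum>(x, y)\<in>{(x, y)\<in>splits u. x \<noteq> [] \<and> y \<noteq> []}. g (x @ v # y))"
    unfolding Z_eq
    by (rule sum.UNION_disjoint) (use fin in \<open>auto dest: splitsD\<close>)
  finally show "sum g (words e (insert v V)) =
      (\<Sum>u\<in>words e V. (\<Sum>(x, y)\<in>splits u. g (x @ 0 # v # 0 # y)) +
        (\<Sum>(x, y)\<in>{(x, y)\<in>splits u. x \<noteq> [] \<and> y \<noteq> []}. g (x @ v # y)))"
    by (simp add: sum.distrib)
qed

section \<open>Weighted sums over words and their path recursion\<close>

context
  fixes p q :: "'a::comm_ring_1" and Q :: "nat \<Rightarrow> nat \<Rightarrow> nat \<Rightarrow> bool"
begin

definition word_wt :: "nat list \<Rightarrow> 'a" where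
  "word_wt u = p ^ pat Q u * q ^ pat asc (rev u)"

text \<open>Across \<open>v\<close>, \<open>Q\<close> counts zeros to the right and the reversed
  word those to the left. Joining two blocks uses up the chosen zero, so the leading zero, and for
  \<open>e = 0\<close> the final one, no longer contributes.\<close>

lemma word_wt_insert:
  assumes V: "finite V" "v > 0" "\<forall>x\<in>V. v < x"
    and Q: "Q = asc \<and> e = 0 \<or> Q = des \<and> e \<in> V"
    and u: "u \<in> words e V" and xy: "(x, y) \<in> splits u"
  shows "word_wt (x @ 0 # v # 0 # y) = word_wt u * (p ^ zeros y * q ^ zeros x)"
    and "x \<noteq> [] \<Longrightarrow> y \<noteq> [] \<Longrightarrow>
      word_wt (x @ v # y) = word_wt u * (p ^ (if e = 0 then zeros y - 1 else zeros y) * q ^ (zeros x - 1))"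
proof -
  have u_eq: "u = x @ 0 # y" using xy by (rule splitsD)
  have letters: "\<forall>w\<in>set (x @ 0 # y). w = 0 \<or> v < w"
    using set_words[OF u V(1)] V(3) by (auto simp: u_eq)
  have "alt True (x @ 0 # y)" using u by (simp add: words_def u_eq)
  then have alt: "alt True (x @ [0])" "alt True (0 # y)"
    using even_length_split[of x y] alt_append[of True x 0 y] by auto
  have hd: "hd (x @ [0]) = 0" using u by (cases x) (auto simp: words_def u_eq)
  have last: "last (0 # y) = e" using u by (simp add: words_def u_eq)
  have Q': "Q = asc \<or> Q = des" using Q by auto
  have e_pos: "e \<noteq> 0" if "e \<in> V" using that V by auto

  obtain t where t: "x @ [0] = 0 # t" using hd by (cases "x @ [0]") auto
  \<comment> \<open>Of the zeros of \<open>x @ [0]\<close> only the leading one is not entered by a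
    descent.\<close>
  have left: "adj (des v) (x @ [0]) = zeros x"
  proof -
    have "alt True (0 # t)" using alt(1) by (simp only: t)
    moreover have "\<forall>w\<in>set (0 # t). w = 0 \<or> v < w" unfolding t [symmetric] using letters by auto
    ultimately have "adj (des v) (0 # t) = zeros t" using V(2) by (rule adj_des_eq_zeros)
    moreover have "Suc (zeros x) = zeros (x @ [0])" by simp
    then have "Suc (zeros x) = Suc (zeros t)" unfolding t by simp
    ultimately show ?thesis by (simp add: t)
  qed
  \<comment> \<open>For \<open>asc\<close> the final \<open>0\<close> drops out in place of the
    chosen one; for \<open>des\<close> the chosen one itself does.\<close>
  have "adj (Q v) (0 # y) = zeros y"
  proof (cases "e = 0")
    case True
    then have "Q = asc" using Q e_pos by auto
    moreover have "adj (asc v) (0 # y) = zeros (butlast (0 # y))"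
      by (rule adj_asc_eq_zeros[of True]) (use alt letters V in auto)
    moreover have "zeros (0 # y) = zeros (butlast (0 # y) @ [last (0 # y)])"
      by (simp only: append_butlast_last_id list.distinct not_False_eq_True)
    ultimately show ?thesis using last True by simp
  next
    case False
    then have "Q = des" using Q by auto
    moreover have "adj (des v) (0 # y) = zeros y"
      by (rule adj_des_eq_zeros[of True]) (use alt letters V in auto)
    ultimately show ?thesis by simp
  qed
  moreover have "adj (asc v) (0 # rev x) = zeros x"
    using adj_asc_rev[of v "x @ [0]"] left by simp
  ultimately show "word_wt (x @ 0 # v # 0 # y) = word_wt u * (p ^ zeros y * q ^ zeros x)"
    using pat_insert[of Q x v y, OF Q'] pat_insert[of asc "rev y" v "rev x"] letters
    by (simp add: word_wt_def u_eq power_add algebra_simps)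

  assume ne: "x \<noteq> []" "y \<noteq> []"
  obtain x' where x: "x = 0 # x'" using ne(1) hd by (cases x) auto
  obtain b y' where y: "y = b # y'" using ne(2) by (cases y) auto
  have b: "b \<noteq> 0" "alt False (b # y')" using alt(2) by (auto simp: y)
  have "adj (Q v) y = (if e = 0 then zeros y - 1 else zeros y)"
  proof (cases "e = 0")
    case True
    then have "Q = asc" using Q e_pos by auto
    moreover have "adj (asc v) (b # y') = zeros (butlast (b # y'))"
      by (rule adj_asc_eq_zeros[of False]) (use b letters V y in auto)
    moreover have "zeros y = zeros (butlast y @ [last y])" using ne(2) by simp
    moreover have "last y = 0" using last True ne(2) by simp
    ultimately show ?thesis using True by (simp add: y)
  next
    case False
    then have "Q = des" using Q by auto
    moreover have "adj (des v) (b # y') = zeros y'"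
      by (rule adj_des_eq_zeros[of False]) (use b letters V y in auto)
    ultimately show ?thesis using False b by (simp add: y)
  qed
  moreover have "alt True (0 # x')"
    using alt(1) unfolding x by (rule alt_snocD)
  then have "adj (des v) (0 # x') = zeros x'"
    by (rule adj_des_eq_zeros) (use letters V x in auto)
  then have "adj (asc v) (rev x) = zeros x - 1"
    unfolding adj_asc_rev by (simp add: x)
  ultimately show "word_wt (x @ v # y) =
      word_wt u * (p ^ (if e = 0 then zeros y - 1 else zeros y) * q ^ (zeros x - 1))"
    using pat_replace[of Q x v y, OF Q'] pat_replace[of asc "rev y" v "rev x"] letters
    by (simp add: word_wt_def u_eq power_add algebra_simps)
qed

text \<open>Stripping the first letter, and for \<open>e = 0\<close> also the last, leaves a word to
  which \<open>sum_splits\<close> applies.\<close>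

lemma sum_splits_inner:
  assumes V: "finite V" "0 \<notin> V" and e: "e = 0 \<or> e \<in> V" and u: "u \<in> words e V"
  shows "(\<Sum>(x, y)\<in>{(x, y)\<in>splits u. x \<noteq> [] \<and> y \<noteq> []}.
      p ^ (if e = 0 then zeros y - 1 else zeros y) * q ^ (zeros x - 1)) =
    bracket p q (zeros u - (if e = 0 then 2 else 1))"
proof -
  obtain t where t: "u = 0 # t" using u by (cases u) (auto simp: words_def)
  have inj: "inj_on (\<lambda>(x, y). (0 # x, y)) S" for S :: "(nat list \<times> nat list) set"
    by (auto simp: inj_on_def)
  show ?thesis
  proof (cases "e = 0")
    case True
    show ?thesis
    proof (cases t rule: rev_cases)
      case Nil
      \<comment> \<open>In \<open>[0]\<close> one zero is both ends; \<open>zeros u - 2\<close>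
        truncates to \<open>0\<close>, where \<open>bracket\<close> vanishes as required.\<close>
      then have eq: "{(x, y)\<in>splits u. x \<noteq> [] \<and> y \<noteq> []} = {}" by (auto simp: t splits_Cons)
      show ?thesis unfolding eq using True Nil by (simp add: t)
    next
      case (snoc w a)
      have a: "a = 0" using u True by (simp add: words_def t snoc)
      have inj': "inj_on (\<lambda>(x, y). (x, y @ [a])) S" for S :: "(nat list \<times> nat list) set"
        by (auto simp: inj_on_def)
      have "{(x, y)\<in>splits u. x \<noteq> [] \<and> y \<noteq> []} = (\<lambda>(x, y). (0 # x, y)) ` {(x, y) \<in> splits t. y \<noteq> []}"
        by (auto simp: t splits_Cons)
      also have "\<dots> = (\<lambda>(x, y). (0 # x, y)) ` (\<lambda>(x, y). (x, y @ [a])) ` splits w"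
        unfolding snoc splits_snoc_nonempty ..
      finally have "(\<Sum>(x, y)\<in>{(x, y)\<in>splits u. x \<noteq> [] \<and> y \<noteq> []}.
          p ^ (zeros y - 1) * q ^ (zeros x - 1)) = (\<Sum>(x, y)\<in>splits w. p ^ zeros y * q ^ zeros x)"
        by (simp only: sum.reindex[OF inj] sum.reindex[OF inj']) (simp add: case_prod_unfold a)
      then show ?thesis using True a by (simp add: sum_splits t snoc)
    qed
  next
    case False
    have "y \<noteq> []" if "(x, y) \<in> splits u" for x y
      using splitsD[OF that] u False by (auto simp: words_def)
    then have "{(x, y)\<in>splits u. x \<noteq> [] \<and> y \<noteq> []} = {(x, y)\<in>splits u. x \<noteq> []}" by auto
    also have "\<dots> = (\<lambda>(x, y). (0 # x, y)) ` splits t" unfolding t by (rule splits_Cons_nonempty)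
    finally have "(\<Sum>(x, y)\<in>{(x, y)\<in>splits u. x \<noteq> [] \<and> y \<noteq> []}.
        p ^ zeros y * q ^ (zeros x - 1)) = (\<Sum>(x, y)\<in>splits t. p ^ zeros y * q ^ zeros x)"
      by (simp only: sum.reindex[OF inj]) (simp add: case_prod_unfold)
    then show ?thesis using False by (simp add: sum_splits t)
  qed
qed

text \<open>Opening a block chooses any zero and adds one; joining two blocks chooses an inner zero
  and removes it.\<close>

lemma sum_words_step:
  assumes V: "finite V" "v > 0" "\<forall>x\<in>V. v < x"
    and Q: "Q = asc \<and> e = 0 \<or> Q = des \<and> e \<in> V"
    and fin: "finite (words e V)"
  shows "(\<Sum>u\<in>words e (insert v V). word_wt u * \<phi> (zeros u)) =
    (\<Sum>u\<in>words e V. word_wt u * step (bracket p q) (\<lambda>_. 0)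
      (\<lambda>z. bracket p q (z - (if e = 0 then 2 else 1))) \<phi> (zeros u))"
proof -
  let ?g = "\<lambda>u. word_wt u * \<phi> (zeros u)"
  have e: "e = 0 \<or> e \<in> V" using Q by auto
  have "(\<Sum>(x, y)\<in>splits u. ?g (x @ 0 # v # 0 # y)) +
      (\<Sum>(x, y)\<in>{(x, y)\<in>splits u. x \<noteq> [] \<and> y \<noteq> []}. ?g (x @ v # y)) =
      word_wt u * step (bracket p q) (\<lambda>_. 0)
        (\<lambda>z. bracket p q (z - (if e = 0 then 2 else 1))) \<phi> (zeros u)"
    if u: "u \<in> words e V" for u
  proof -
    have "(\<Sum>(x, y)\<in>splits u. ?g (x @ 0 # v # 0 # y)) =
        (\<Sum>(x, y)\<in>splits u. word_wt u * \<phi> (Suc (zeros u)) * (p ^ zeros y * q ^ zeros x))"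
      by (rule sum.cong[OF refl])
        (use V(2) word_wt_insert(1)[OF V Q u] in \<open>auto dest!: splitsD simp: splits_def algebra_simps\<close>)
    also have "\<dots> = word_wt u * \<phi> (Suc (zeros u)) * (\<Sum>(x, y)\<in>splits u. p ^ zeros y * q ^ zeros x)"
      by (simp add: sum_distrib_left case_prod_unfold)
    finally have 1: "(\<Sum>(x, y)\<in>splits u. ?g (x @ 0 # v # 0 # y)) =
        word_wt u * \<phi> (Suc (zeros u)) * bracket p q (zeros u)"
      by (simp only: sum_splits)
    let ?w = "\<lambda>x y. p ^ (if e = 0 then zeros y - 1 else zeros y) * q ^ (zeros x - 1)"
    have "(\<Sum>(x, y)\<in>{(x, y)\<in>splits u. x \<noteq> [] \<and> y \<noteq> []}. ?g (x @ v # y)) =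
        (\<Sum>(x, y)\<in>{(x, y)\<in>splits u. x \<noteq> [] \<and> y \<noteq> []}. word_wt u * \<phi> (zeros u - 1) * ?w x y)"
    proof (rule sum.cong[OF refl], clarify)
      fix x y assume *: "(x, y) \<in> splits u" "x \<noteq> []" "y \<noteq> []"
      have "zeros (x @ v # y) = zeros u - 1" using splitsD[OF *(1)] V(2) by simp
      then show "?g (x @ v # y) = word_wt u * \<phi> (zeros u - 1) * ?w x y"
        using word_wt_insert(2)[OF V Q u *] by (simp only: mult_ac)
    qed
    also have "\<dots> = word_wt u * \<phi> (zeros u - 1) *
        (\<Sum>(x, y)\<in>{(x, y)\<in>splits u. x \<noteq> [] \<and> y \<noteq> []}. ?w x y)"
      unfolding case_prod_unfold by (simp only: sum_distrib_left)
    also have "(\<Sum>(x, y)\<in>{(x, y)\<in>splits u. x \<noteq> [] \<and> y \<noteq> []}. ?w x y) =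
        bracket p q (zeros u - (if e = 0 then 2 else 1))"
      by (rule sum_splits_inner[OF V(1) _ e u]) (use V in auto)
    finally show ?thesis using 1 by (simp add: step_def algebra_simps)
  qed
  then show ?thesis unfolding sum_words_insert(2)[OF V e fin] by (rule sum.cong[OF refl])
qed

text \<open>The letters \<open>n\<close>, \<open>n - 1\<close>, ... enter in turn, each the smallest
  so far; \<open>E\<close> serves for a large end letter present from the start.\<close>

lemma sum_words_funpow:
  assumes E: "finite E" "\<forall>x\<in>E. n < x" and Q: "Q = asc \<and> e = 0 \<or> Q = des \<and> e \<in> E"
    and fin: "finite (words e E)" and "k \<le> n"
  shows "finite (words e ({n - k<..n} \<union> E)) \<and>
    (\<Sum>u\<in>words e ({n - k<..n} \<union> E). word_wt u * \<phi> (zeros u)) =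
    (\<Sum>u\<in>words e E. word_wt u * (step (bracket p q) (\<lambda>_. 0)
      (\<lambda>z. bracket p q (z - (if e = 0 then 2 else 1))) ^^ k) \<phi> (zeros u))"
  using \<open>k \<le> n\<close>
proof (induction k arbitrary: \<phi>)
  case 0
  then show ?case using fin by simp
next
  case (Suc k)
  let ?V = "{n - k<..n} \<union> E"
  have V_Suc: "{n - Suc k<..n} \<union> E = insert (n - k) ?V" using Suc.prems by auto
  have V: "finite ?V" "n - k > 0" "\<forall>x\<in>?V. n - k < x" using E Suc.prems by fastforce+
  have Q': "Q = asc \<and> e = 0 \<or> Q = des \<and> e \<in> ?V" using Q by auto
  have fin': "finite (words e ?V)" using Suc by simp
  have e: "e = 0 \<or> e \<in> ?V" using Q' by auto
  show ?case
    unfolding V_Suc sum_words_step[OF V Q' fin'] funpow_Suc_right comp_apply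
    using sum_words_insert(1)[OF V e fin'] Suc by simp
qed

end

lemma words_base_odd: "words 0 {} = {[0]}"
proof -
  have "u = [0]" if "u \<in> words 0 {}" for u
  proof -
    have *: "hd u = 0" "alt True u" "u \<noteq> []" and "set u \<subseteq> {0}"
      using that set_words[OF that] by (auto simp: words_def)
    then show ?thesis by (cases u rule: list.exhaust; cases "tl u") auto
  qed
  then show ?thesis by (auto simp: words_def)
qed

lemma words_base_even:
  assumes "N > 0"
  shows "words N {N} = {[0, N]}"
proof -
  have "u = [0, N]" if "u \<in> words N {N}" for u
  proof -
    have *: "hd u = 0" "alt True u" "last u = N" "u \<noteq> []"
      "filter_mset (\<lambda>x. 0 < x) (mset u) = {#N#}" and set: "set u \<subseteq> {0, N}"
      using that set_words[OF that] by (auto simp: words_def)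
    obtain a t where u: "u = 0 # a # t"
      using * assms by (cases u rule: list.exhaust; cases "tl u") auto
    have a: "a = N" using * set by (auto simp: u)
    have eq: "filter_mset (\<lambda>x. 0 < x) (mset t) = {#}" using * a assms by (simp add: u)
    have "x \<in># {#}" if "x \<in> set t" "x \<noteq> 0" for x unfolding eq [symmetric] using that by simp
    then have "set t \<subseteq> {0}" by auto
    moreover have "t \<noteq> [] \<Longrightarrow> last t = N" using * by (simp add: u)
    ultimately have "t = []" using assms last_in_set[of t] by fastforce
    then show ?thesis using a by (simp add: u)
  qed
  then show ?thesis using assms by (auto simp: words_def)
qed

section \<open>Permutations as padded words\<close>

lemma alt_iff_nth:
  "alt b xs \<longleftrightarrow> (\<forall>i. Suc i < length xs \<longrightarrow>
    (if b = even i then xs ! i < xs ! Suc i else xs ! Suc i < xs ! i))"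
proof (induction xs arbitrary: b)
  case (Cons x xs)
  show ?case
  proof (cases xs)
    case (Cons y ys)
    have split: "(\<forall>i. P i) \<longleftrightarrow> P 0 \<and> (\<forall>i. P (Suc i))" for P :: "nat \<Rightarrow> bool"
      by (metis nat.exhaust)
    have "(\<forall>i. Suc i < length (x # xs) \<longrightarrow>
        (if b = even i then (x # xs) ! i < (x # xs) ! Suc i else (x # xs) ! Suc i < (x # xs) ! i)) \<longleftrightarrow>
      (if b then x < y else y < x) \<and> (\<forall>i. Suc i < length xs \<longrightarrow>
        (if (\<not> b) = even i then xs ! i < xs ! Suc i else xs ! Suc i < xs ! i))"
      unfolding Cons by (subst split) auto
    then show ?thesis using Cons.IH[of "\<not> b"] Cons by simp
  qed simp
qed simp

lemma adj_map_upt: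
  "adj P (map \<sigma> [m..<k]) = card {j. m \<le> j \<and> Suc j < k \<and> P (\<sigma> j) (\<sigma> (Suc j))}"
proof (induction "k - m" arbitrary: m)
  case 0
  then show ?case by (auto simp: card_eq_0_iff)
next
  case (Suc d)
  then have m: "m < k" "d = k - Suc m" by auto
  show ?case
  proof (cases "Suc m < k")
    case True
    let ?S = "\<lambda>m. {j. m \<le> j \<and> Suc j < k \<and> P (\<sigma> j) (\<sigma> (Suc j))}"
    have "?S m = (if P (\<sigma> m) (\<sigma> (Suc m)) then {m} else {}) \<union> ?S (Suc m)"
      using True by (auto simp: Suc_le_eq order_le_less)
    then have "card (?S m) = of_bool (P (\<sigma> m) (\<sigma> (Suc m))) + card (?S (Suc m))"
      by (subst \<open>?S m = _\<close>, subst card_Un_disjoint) (auto intro: finite_subset[of _ "{..<k}"])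
    then show ?thesis using Suc(1)[OF m(2)] True m(1) by (simp add: upt_conv_Cons)
  next
    case False
    then have "k = Suc m" "{j. m \<le> j \<and> Suc j < k \<and> P (\<sigma> j) (\<sigma> (Suc j))} = {}"
      using m by auto
    then show ?thesis by simp
  qed
qed

lemma pat_map_upt:
  "pat Q (map \<sigma> [m..<k]) = card {(i, j). m \<le> i \<and> i < j \<and> Suc j < k \<and> Q (\<sigma> i) (\<sigma> j) (\<sigma> (Suc j))}"
proof (induction "k - m" arbitrary: m)
  case 0
  then show ?case by (auto simp: card_eq_0_iff)
next
  case (Suc d)
  then have m: "m < k" "d = k - Suc m" by auto
  let ?S = "\<lambda>m. {(i, j). m \<le> i \<and> i < j \<and> Suc j < k \<and> Q (\<sigma> i) (\<sigma> j) (\<sigma> (Suc j))}"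
  let ?T = "{j. Suc m \<le> j \<and> Suc j < k \<and> Q (\<sigma> m) (\<sigma> j) (\<sigma> (Suc j))}"
  have fin: "finite (?S i)" for i by (rule finite_subset[of _ "{..<k} \<times> {..<k}"]) auto
  have fin': "finite ?T" by (rule finite_subset[of _ "{..<k}"]) auto
  have "?S m = Pair m ` ?T \<union> ?S (Suc m)"
    by (auto simp: Suc_le_eq order_le_less)
  then have "card (?S m) = card (Pair m ` ?T \<union> ?S (Suc m))" by (simp only:)
  also have "\<dots> = card (Pair m ` ?T) + card (?S (Suc m))"
    using fin fin' by (intro card_Un_disjoint) auto
  also have "card (Pair m ` ?T) = card ?T" by (rule card_image) (simp add: inj_on_def)
  finally have "card (?S m) = card ?T + card (?S (Suc m))" .
  then show ?case using Suc(1)[OF m(2)] m(1) by (simp add: upt_conv_Cons adj_map_upt)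
qed

text \<open>Reversal turns 31-2 into 2-13; the induction peels off the last letter in its role as
  2.\<close>

lemma pat_rev_map_upt:
  "pat asc (rev (map \<sigma> [1..<Suc n])) = pat_31_2 n \<sigma>"
proof (induction n)
  case 0
  show ?case by (auto simp: pat_31_2_def card_eq_0_iff)
next
  case (Suc n)
  let ?S = "\<lambda>n. {(i, j). 2 \<le> i \<and> i < j \<and> j \<le> n \<and> \<sigma> (i - 1) > \<sigma> j \<and> \<sigma> j > \<sigma> i}"
  let ?T = "{i. 1 \<le> i \<and> Suc i < Suc n \<and> des (\<sigma> (Suc n)) (\<sigma> i) (\<sigma> (Suc i))}"
  have fin: "finite (?S i)" for i by (rule finite_subset[of _ "{..i} \<times> {..i}"]) auto
  have fin': "finite ?T" by (rule finite_subset[of _ "{..n}"]) auto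
  have "?S (Suc n) = (\<lambda>i. (Suc i, Suc n)) ` ?T \<union> ?S n"
  proof
    show "?S (Suc n) \<subseteq> (\<lambda>i. (Suc i, Suc n)) ` ?T \<union> ?S n"
    proof
      fix x assume x: "x \<in> ?S (Suc n)"
      then obtain i j where ij: "x = (i, j)" "2 \<le> i" "i < j" "j \<le> Suc n" "\<sigma> (i - 1) > \<sigma> j" "\<sigma> j > \<sigma> i"
        by auto
      show "x \<in> (\<lambda>i. (Suc i, Suc n)) ` ?T \<union> ?S n"
      proof (cases "j = Suc n")
        case True
        with ij have "i - 1 \<in> ?T" "x = (Suc (i - 1), Suc n)" by (auto simp: des_def)
        then show ?thesis by blast
      next
        case False
        then show ?thesis using ij by auto
      qed
    qed
  qed (auto simp: des_def)
  then have "card (?S (Suc n)) = card ((\<lambda>i. (Suc i, Suc n)) ` ?T \<union> ?S n)" by (simp only:)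
  also have "\<dots> = card ((\<lambda>i. (Suc i, Suc n)) ` ?T) + card (?S n)"
    using fin fin' by (intro card_Un_disjoint) auto
  also have "card ((\<lambda>i. (Suc i, Suc n)) ` ?T) = card ?T" by (rule card_image) (simp add: inj_on_def)
  finally have "pat_31_2 (Suc n) \<sigma> = card ?T + pat_31_2 n \<sigma>" by (simp add: pat_31_2_def)
  moreover have "rev (map \<sigma> [1..<Suc (Suc n)]) = \<sigma> (Suc n) # rev (map \<sigma> [1..<Suc n])" by simp
  then have "pat asc (rev (map \<sigma> [1..<Suc (Suc n)])) =
      adj (des (\<sigma> (Suc n))) (map \<sigma> [1..<Suc n]) + pat asc (rev (map \<sigma> [1..<Suc n]))"
    by (simp only: pat.simps adj_asc_rev)
  ultimately show ?case using Suc by (simp only: adj_map_upt)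
qed

lemma pat_asc_map_upt: "pat asc (map \<sigma> [1..<Suc n]) = pat_2_13 n \<sigma>"
  unfolding pat_map_upt pat_2_13_def by (rule arg_cong[where f = card]) (auto simp: asc_def)

lemma pat_des_map_upt: "pat des (map \<sigma> [1..<Suc n]) = pat_2_31 n \<sigma>"
  unfolding pat_map_upt pat_2_31_def by (rule arg_cong[where f = card]) (auto simp: des_def)

lemma pat_snoc:
  assumes "\<And>x b. x \<in> set xs \<Longrightarrow> \<not> Q x b a"
  shows "pat Q (xs @ [a]) = pat Q xs"
  using assms
proof (induction xs)
  case (Cons x xs)
  have "adj (Q x) (xs @ [a]) = adj (Q x) xs"
  proof (cases xs rule: rev_cases)
    case (snoc ys b)
    then show ?thesis using Cons.prems[of x b] by (simp add: adj_snoc2)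
  qed simp
  then show ?case using Cons by simp
qed simp

text \<open>The leading \<open>0\<close> aligns list index \<open>i\<close> with position
  \<open>i\<close>, so the parities in \<open>alt\<close> match those of the permutation.\<close>

definition pad :: "nat \<Rightarrow> nat \<Rightarrow> (nat \<Rightarrow> nat) \<Rightarrow> nat list" where
  "pad n e \<sigma> = 0 # map \<sigma> [1..<Suc n] @ [e]"

lemma set_map_perm:
  assumes "\<sigma> \<in> perms n"
  shows "set (map \<sigma> [1..<Suc n]) = {1..n}"
  using assms permutes_image[of \<sigma> "{1..n}"]
  by (simp add: perms_def atLeastLessThanSuc_atLeastAtMost del: upt_Suc)

text \<open>The padding creates no pattern: an end \<open>0\<close> cannot be the 3 of 2-13, and an
  end \<open>Suc n\<close> cannot be the 1 of 2-31. This fixes which statistic belongs to which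
  parity.\<close>

lemma word_wt_pad:
  fixes p q :: "'a::comm_ring_1"
  assumes "\<sigma> \<in> perms n"
  shows "word_wt p q asc (pad n 0 \<sigma>) = p ^ pat_2_13 n \<sigma> * q ^ pat_31_2 n \<sigma>"
    and "word_wt p q des (pad n (Suc n) \<sigma>) = p ^ pat_2_31 n \<sigma> * q ^ pat_31_2 n \<sigma>"
proof -
  let ?w = "map \<sigma> [1..<Suc n]"
  have set: "set ?w = {1..n}" by (rule set_map_perm[OF assms])
  have "pat asc (rev (pad n e \<sigma>)) = pat_31_2 n \<sigma>" if "e = 0 \<or> e = Suc n" for e
  proof -
    have "adj (asc e) (rev ?w @ [0]) = 0"
      by (rule adj_eq_0) (use that set in \<open>auto simp: asc_def simp del: upt_Suc\<close>)
    moreover have "pat asc (rev ?w @ [0]) = pat asc (rev ?w)"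
      by (rule pat_snoc) (auto simp: asc_def)
    moreover have "rev (pad n e \<sigma>) = e # (rev ?w @ [0])" by (simp add: pad_def)
    ultimately show ?thesis by (simp only: pat.simps pat_rev_map_upt add_0)
  qed
  moreover have "pat asc (pad n 0 \<sigma>) = pat_2_13 n \<sigma>"
  proof -
    have "pat asc (?w @ [0]) = pat asc ?w" by (rule pat_snoc) (auto simp: asc_def)
    then show ?thesis unfolding pad_def pat.simps pat_asc_map_upt by (simp add: adj_0)
  qed
  moreover have "pat des (pad n (Suc n) \<sigma>) = pat_2_31 n \<sigma>"
  proof -
    have "pat des (?w @ [Suc n]) = pat des ?w"
      by (rule pat_snoc) (use set in \<open>auto simp: des_def simp del: upt_Suc\<close>)
    then show ?thesis unfolding pad_def pat.simps pat_des_map_upt by (simp add: adj_0)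
  qed
  ultimately show "word_wt p q asc (pad n 0 \<sigma>) = p ^ pat_2_13 n \<sigma> * q ^ pat_31_2 n \<sigma>"
    "word_wt p q des (pad n (Suc n) \<sigma>) = p ^ pat_2_31 n \<sigma> * q ^ pat_31_2 n \<sigma>"
    by (simp_all add: word_wt_def)
qed

text \<open>The first step rises from \<open>0\<close>, and the last one falls to \<open>0\<close>
  for odd \<open>n\<close> and rises to \<open>Suc n\<close> for even \<open>n\<close>, so the
  padding imposes nothing new.\<close>

lemma alt_pad:
  assumes "\<sigma> \<in> perms n" "n \<ge> 1" "odd n \<and> e = 0 \<or> even n \<and> e = Suc n"
  shows "alt True (pad n e \<sigma>) \<longleftrightarrow> \<sigma> \<in> falling_alternating n"
proof -
  have s: "\<sigma> permutes {1..n}" using assms(1) by (simp add: perms_def)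
  have range: "1 \<le> \<sigma> i \<and> \<sigma> i \<le> n" if "1 \<le> i" "i \<le> n" for i
    using that permutes_in_image[OF s, of i] by simp
  define u where "u = pad n e \<sigma>"
  have len: "length u = n + 2" by (simp add: u_def pad_def)
  have nth: "u ! 0 = 0" "u ! Suc n = e" "\<And>i. 1 \<le> i \<Longrightarrow> i \<le> n \<Longrightarrow> u ! i = \<sigma> i"
    by (auto simp: u_def pad_def nth_Cons' nth_append simp del: upt_Suc)
  let ?C = "\<lambda>i. if even i then u ! i < u ! Suc i else u ! Suc i < u ! i"
  have idx: "Suc i < length u \<longleftrightarrow> i = 0 \<or> i = n \<or> i \<in> {1..<n}" for i
    using assms(2) by (auto simp: len)
  have ends: "(\<forall>i. Suc i < length u \<longrightarrow> P i) \<longleftrightarrow> (\<forall>i\<in>{1..<n}. P i)" if "P 0" "P n" for P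
    unfolding idx using that by blast
  have "?C 0" using nth(1) nth(3)[of 1] range[of 1] assms(2) by simp
  moreover have "?C n" using nth(2) nth(3)[of n] range[of n] assms(2,3) by auto
  ultimately have "(\<forall>i. Suc i < length u \<longrightarrow> ?C i) \<longleftrightarrow> (\<forall>i\<in>{1..<n}. ?C i)"
    by (intro ends)
  also have "\<dots> \<longleftrightarrow> \<sigma> \<in> falling_alternating n"
    using assms(1) nth(3) by (auto simp: falling_alternating_def)
  finally show ?thesis unfolding alt_iff_nth u_def [symmetric] by simp
qed

text \<open>A word whose only zeros are end letters has no unfilled valley; its inner letters form
  the multiset \<open>{1..n}\<close> and hence a permutation.\<close>

lemma bij_betw_pad:
  assumes n: "n \<ge> 1" and e: "odd n \<and> e = 0 \<or> even n \<and> e = Suc n"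
  defines "E \<equiv> (if e = 0 then {} else {e})"
  shows "bij_betw (pad n e) (falling_alternating n)
    {u \<in> words e ({1..n} \<union> E). zeros u = (if e = 0 then 2 else 1)}"
  unfolding bij_betw_def
proof
  have eq: "\<sigma> i = \<tau> i" if "\<sigma> \<in> perms n" "\<tau> \<in> perms n" "pad n e \<sigma> = pad n e \<tau>" for \<sigma> \<tau> i
  proof (cases "i \<in> {1..n}")
    case True
    have "map \<sigma> [1..<Suc n] = map \<tau> [1..<Suc n]"
      using that(3) by (simp add: pad_def del: upt_Suc)
    then have "\<forall>i\<in>set [1..<Suc n]. \<sigma> i = \<tau> i" by (simp only: map_eq_conv)
    then show ?thesis using True by (simp del: upt_Suc)
  next
    case False
    then show ?thesis using that by (simp add: perms_def permutes_not_in)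
  qed
  then show "inj_on (pad n e) (falling_alternating n)"
    by (auto simp: inj_on_def falling_alternating_def)
  have E: "mset_set ({1..n} \<union> E) = mset_set {1..n} + mset_set E"
    by (rule mset_set_Union) (use e in \<open>auto simp: E_def\<close>)
  show "pad n e ` falling_alternating n =
    {u \<in> words e ({1..n} \<union> E). zeros u = (if e = 0 then 2 else 1)}" (is "_ = ?R")
  proof
    show "pad n e ` falling_alternating n \<subseteq> ?R"
    proof
      fix u assume "u \<in> pad n e ` falling_alternating n"
      then obtain \<sigma> where \<sigma>: "\<sigma> \<in> falling_alternating n" and u: "u = pad n e \<sigma>" by auto
      have perm: "\<sigma> \<in> perms n" using \<sigma> by (simp add: falling_alternating_def)
      let ?w = "map \<sigma> [1..<Suc n]"
      have "inj_on \<sigma> {1..n}" using perm permutes_inj_on by (auto simp: perms_def)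
      then have "distinct ?w" by (simp add: distinct_map atLeastLessThanSuc_atLeastAtMost del: upt_Suc)
      then have mset: "mset ?w = mset_set {1..n}"
        using mset_set_set[of ?w] set_map_perm[OF perm] by simp
      have "filter (\<lambda>x. 0 < x) ?w = ?w"
        using set_map_perm[OF perm] by (intro filter_True) auto
      then have "filter_mset (\<lambda>x. 0 < x) (mset ?w) = mset ?w" by (metis mset_filter)
      moreover have "count_list ?w 0 = 0"
        using set_map_perm[OF perm] by (simp add: count_list_0_iff del: upt_Suc)
      ultimately show "u \<in> ?R"
        using mset alt_pad[OF perm n e] \<sigma> E e unfolding u
        by (auto simp: words_def pad_def E_def simp del: upt_Suc)
    qed
    show "?R \<subseteq> pad n e ` falling_alternating n"
    proof
      fix u assume u: "u \<in> ?R"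
      have "set u \<subseteq> insert 0 ({1..n} \<union> E)"
        by (rule set_words[of u e]) (use u in \<open>auto simp: E_def\<close>)
      have "filter_mset (\<lambda>x. 0 < x) (mset u) = mset_set ({1..n} \<union> E)"
        using u by (simp add: words_def)
      \<comment> \<open>The letter \<open>1\<close> makes \<open>u\<close> longer than
        \<open>[0]\<close>, so two separate end letters can be stripped.\<close>
      moreover have "Suc 0 \<in># mset_set ({1..n} \<union> E)" using n by (simp add: E_def)
      ultimately have "Suc 0 \<in> set u" by (metis filter_mset_eq_conv mset_subset_eqD multiset_filter_subset set_mset_mset)
      then obtain w where w: "u = 0 # w @ [e]"
        using u by (cases u; cases "tl u" rule: rev_cases) (auto simp: words_def)
      have zeros: "zeros w = 0" using u by (auto simp: w split: if_splits)
      then have "filter (\<lambda>x. 0 < x) w = w"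
        by (intro filter_True) (auto simp: count_list_0_iff intro: gr0I)
      then have filter: "filter_mset (\<lambda>x. 0 < x) (mset w) = mset w" by (metis mset_filter)
      then have mset: "mset w = mset_set {1..n}"
        using u e filter unfolding E by (auto simp: words_def w E_def split: if_splits)
      have "mset w = mset (sorted_list_of_set {1..n})"
        unfolding mset using mset_set_set[of "sorted_list_of_set {1..n}"] by simp
      then have dist: "distinct w" by (metis distinct_sorted_list_of_set mset_eq_imp_distinct_iff)
      have set: "set w = {1..n}" using arg_cong[OF mset, of set_mset] by simp
      have len: "length w = n" using distinct_card[OF dist] set by simp
      define \<sigma> where "\<sigma> i = (if i \<in> {1..n} then w ! (i - 1) else i)" for i
      have w_eq: "w = map \<sigma> [1..<Suc n]"
        by (rule nth_equalityI) (auto simp: len \<sigma>_def simp del: upt_Suc)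
      have "bij_betw \<sigma> {1..n} {1..n}"
        unfolding bij_betw_def
      proof
        show "inj_on \<sigma> {1..n}"
          using dist unfolding w_eq by (simp add: distinct_map atLeastLessThanSuc_atLeastAtMost del: upt_Suc)
        show "\<sigma> ` {1..n} = {1..n}"
          using set unfolding w_eq by (simp add: atLeastLessThanSuc_atLeastAtMost del: upt_Suc)
      qed
      moreover have "\<sigma> i = i" if "i \<notin> {1..n}" for i
        using that unfolding \<sigma>_def by (rule if_not_P)
      ultimately have perm: "\<sigma> \<in> perms n" unfolding perms_def by (blast intro: bij_imp_permutes)
      have u_eq: "u = pad n e \<sigma>" unfolding w w_eq pad_def ..
      moreover have "alt True u" using u by (simp add: words_def)
      ultimately show "u \<in> pad n e ` falling_alternating n"
        using alt_pad[OF perm n e] by blast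
    qed
  qed
qed

text \<open>Both starting words contain one zero, hence height \<open>1\<close>; the final height
  counts the zeros among the end letters.\<close>

lemma sum_falling_alternating:
  fixes p q :: "'a::comm_ring_1"
  assumes n: "n \<ge> 1" and e: "odd n \<and> e = 0 \<and> Q = asc \<or> even n \<and> e = Suc n \<and> Q = des"
  shows "(\<Sum>\<sigma>\<in>falling_alternating n. word_wt p q Q (pad n e \<sigma>)) =
    (step (bracket p q) (\<lambda>_. 0) (\<lambda>z. bracket p q (z - (if e = 0 then 2 else 1))) ^^ n)
      (\<lambda>z. of_bool (z = (if e = 0 then 2 else 1))) 1"
proof -
  define E where "E = (if e = 0 then {} else {e})"
  define \<phi> :: "nat \<Rightarrow> 'a" where "\<phi> z = of_bool (z = (if e = 0 then 2 else 1))" for z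
  let ?T = "step (bracket p q) (\<lambda>_. 0) (\<lambda>z. bracket p q (z - (if e = 0 then 2 else 1)))"
  have base: "words e E = {if e = 0 then [0] else [0, e]}"
    using words_base_odd words_base_even[of e] by (simp add: E_def)
  have E: "finite E" "\<forall>x\<in>E. n < x" "Q = asc \<and> e = 0 \<or> Q = des \<and> e \<in> E" "finite (words e E)"
    using e base by (auto simp: E_def)
  have "{n - n<..n} = {1..n}" by auto
  with sum_words_funpow[OF E le_refl, of p q \<phi>]
  have *: "finite (words e ({1..n} \<union> E))"
    "(\<Sum>u\<in>words e ({1..n} \<union> E). word_wt p q Q u * \<phi> (zeros u)) = (?T ^^ n) \<phi> 1"
    unfolding base by (simp_all add: word_wt_def)
  have bij: "bij_betw (pad n e) (falling_alternating n)
      {u \<in> words e ({1..n} \<union> E). zeros u = (if e = 0 then 2 else 1)}"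
    unfolding E_def by (rule bij_betw_pad[OF n]) (use e in auto)
  have "(\<Sum>\<sigma>\<in>falling_alternating n. word_wt p q Q (pad n e \<sigma>)) =
      (\<Sum>u\<in>{u \<in> words e ({1..n} \<union> E). zeros u = (if e = 0 then 2 else 1)}. word_wt p q Q u)"
    by (rule sum.reindex_bij_betw[OF bij])
  also have "\<dots> = (\<Sum>u\<in>words e ({1..n} \<union> E). word_wt p q Q u * \<phi> (zeros u))"
    using *(1) by (intro sum.mono_neutral_cong_left) (auto simp: \<phi>_def)
  finally show ?thesis unfolding *(2) by (simp only: \<phi>_def [abs_def])
qed

section \<open>Comparison of the two sums\<close>

text \<open>For \<open>y = z = - 1\<close> the level weights are differences of consecutive
  brackets, the shape that \<open>funpow_step_contract\<close> factors.\<close>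

lemma signed_sum_perms:
  fixes p q :: "'a::comm_ring_1"
  shows "(\<Sum>\<sigma>\<in>perms (Suc m). (- 1) ^ wex (Suc m) \<sigma> * p ^ nest (Suc m) \<sigma> * q ^ cros (Suc m) \<sigma>) =
    - (if even m then (- 1) ^ (m div 2) else 0) *
      (step (\<lambda>_. 1) (\<lambda>_. 0) (\<lambda>h. bracket p q h * bracket p q (Suc h)) ^^ m) (\<lambda>h. of_bool (h = 0)) 0"
proof -
  let ?b = "bracket p q" and ?d = "\<lambda>h. of_bool (h = 0) :: 'a"
  have wex: "(- 1) ^ wex (Suc m) \<sigma> =
      (\<Prod>i=1..Suc m. if i < \<sigma> i then - 1 else if i = \<sigma> i then - 1 else (1::'a))" for \<sigma>
  proof -
    have "(\<Prod>i=1..Suc m. if i < \<sigma> i then - 1 else if i = \<sigma> i then - 1 else (1::'a)) =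
        (\<Prod>i=1..Suc m. if i \<le> \<sigma> i then - 1 else 1)"
      by (rule prod.cong) auto
    also have "\<dots> = (- 1) ^ wex (Suc m) \<sigma>"
      unfolding wex_def by (subst prod.inter_filter [symmetric]) simp_all
    finally show ?thesis ..
  qed
  have level: "(\<lambda>h. - 1 * q * ?b h + - 1 * p ^ h + ?b h) = (\<lambda>h. ?b h - ?b (Suc h))"
    "(\<lambda>h. - 1 * (?b h)\<^sup>2) = (\<lambda>h. - (?b h)\<^sup>2)"
    by auto
  \<comment> \<open>Since \<open>bracket p q 1 = 1\<close>, the contraction negates the test
    function; this is the global sign.\<close>
  have start: "(\<lambda>h. ?d (Suc h) - ?b (Suc h) * ?d h) = (\<lambda>h. - 1 * ?d h)"
    by (auto simp: fun_eq_iff)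
  have "(\<Sum>\<sigma>\<in>perms (Suc m). (- 1) ^ wex (Suc m) \<sigma> * p ^ nest (Suc m) \<sigma> * q ^ cros (Suc m) \<sigma>) =
      (step (\<lambda>_. 1) (\<lambda>h. ?b h - ?b (Suc h)) (\<lambda>h. - (?b h)\<^sup>2) ^^ Suc m) ?d 0"
    unfolding wex sum_perms_eq_step level ..
  also have "\<dots> = (step (\<lambda>_. 1) (\<lambda>_. 0) (\<lambda>h. - 1 * (?b h * ?b (Suc h))) ^^ m) (\<lambda>h. - 1 * ?d h) 0"
    by (subst funpow_step_contract) (simp_all only: bracket.simps(1) start)
  also have "\<dots> = (if even m then (- 1) ^ (m div 2) else 0) *
      (step (\<lambda>_. 1) (\<lambda>_. 0) (\<lambda>h. ?b h * ?b (Suc h)) ^^ m) (\<lambda>h. - 1 * ?d h) 0"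
    by (subst funpow_step_scale) simp_all
  finally show ?thesis unfolding funpow_step_mult by (simp only: mult_1_left mult_minus1 mult_minus_left mult_minus_right)
qed

text \<open>With \<open>z = 0\<close> a fixed point kills the product, and
  \<open>y * q = - 1\<close> cancels every level weight.\<close>

lemma signed_sum_derangements:
  fixes p q y :: "'a::comm_ring_1"
  assumes "y * q = - 1"
  shows "(\<Sum>\<sigma>\<in>derangements n. y ^ exc n \<sigma> * p ^ nest n \<sigma> * q ^ cros n \<sigma>) =
    (if even n then y ^ (n div 2) else 0) *
      (step (\<lambda>_. 1) (\<lambda>_. 0) (\<lambda>h. (bracket p q h)\<^sup>2) ^^ n) (\<lambda>h. of_bool (h = 0)) 0"
proof -
  let ?b = "bracket p q"
  let ?w = "\<lambda>\<sigma>. \<Prod>i=1..n. if i < \<sigma> i then y else if i = \<sigma> i then 0 else 1"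
  have exc: "?w \<sigma> = (if \<sigma> \<in> derangements n then y ^ exc n \<sigma> else 0)"
    if perm: "\<sigma> \<in> perms n" for \<sigma>
  proof (cases "\<sigma> \<in> derangements n")
    case True
    then have "\<forall>i\<in>{1..n}. \<sigma> i \<noteq> i" by (simp add: derangements_def)
    then have "i \<noteq> \<sigma> i" if "i \<in> {1..n}" for i using that by metis
    then have "?w \<sigma> = (\<Prod>i=1..n. if i < \<sigma> i then y else 1)"
      by (intro prod.cong) auto
    also have "\<dots> = y ^ exc n \<sigma>"
      unfolding exc_def by (subst prod.inter_filter [symmetric]) simp_all
    finally show ?thesis using True by simp
  next
    case False
    then obtain i where "i \<in> {1..n}" "\<sigma> i = i" using perm by (auto simp: derangements_def)
    then have "?w \<sigma> = 0" by (intro prod_zero bexI[of _ i]) auto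
    then show ?thesis using False by simp
  qed
  have level: "(\<lambda>h. y * q * ?b h + 0 * p ^ h + ?b h) = (\<lambda>_. 0)"
    by (simp add: assms)
  have "(\<Sum>\<sigma>\<in>derangements n. y ^ exc n \<sigma> * p ^ nest n \<sigma> * q ^ cros n \<sigma>) =
      (\<Sum>\<sigma>\<in>perms n. ?w \<sigma> * p ^ nest n \<sigma> * q ^ cros n \<sigma>)"
  proof (rule sum.mono_neutral_cong_left)
    show sub: "derangements n \<subseteq> perms n" by (auto simp: derangements_def)
    show "\<forall>\<sigma>\<in>perms n - derangements n. ?w \<sigma> * p ^ nest n \<sigma> * q ^ cros n \<sigma> = 0"
      using exc by simp
    show "y ^ exc n \<sigma> * p ^ nest n \<sigma> * q ^ cros n \<sigma> = ?w \<sigma> * p ^ nest n \<sigma> * q ^ cros n \<sigma>"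
      if "\<sigma> \<in> derangements n" for \<sigma>
      using exc[of \<sigma>] sub that by auto
  qed simp
  also have "\<dots> = (step (\<lambda>_. 1) (\<lambda>_. 0) (\<lambda>h. y * (?b h)\<^sup>2) ^^ n) (\<lambda>h. of_bool (h = 0)) 0"
    unfolding sum_perms_eq_step level ..
  also have "\<dots> = (if even n then y ^ (n div 2) else 0) *
      (step (\<lambda>_. 1) (\<lambda>_. 0) (\<lambda>h. (?b h)\<^sup>2) ^^ n) (\<lambda>h. of_bool (h = 0)) 0"
    by (subst funpow_step_scale) simp_all
  finally show ?thesis .
qed

lemma sum_falling_alternating_odd:
  fixes p q :: "'a::comm_ring_1"
  assumes "even m"
  shows "(\<Sum>\<sigma>\<in>falling_alternating (Suc m). p ^ pat_2_13 (Suc m) \<sigma> * q ^ pat_31_2 (Suc m) \<sigma>) =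
    (step (\<lambda>_. 1) (\<lambda>_. 0) (\<lambda>h. bracket p q h * bracket p q (Suc h)) ^^ m) (\<lambda>h. of_bool (h = 0)) 0"
proof -
  let ?b = "bracket p q"
  let ?F = "step ?b (\<lambda>_. 0) (\<lambda>z. ?b (z - 2))"
  let ?\<phi> = "\<lambda>z. of_bool (z = 2) :: 'a"
  have "(\<Sum>\<sigma>\<in>falling_alternating (Suc m). p ^ pat_2_13 (Suc m) \<sigma> * q ^ pat_31_2 (Suc m) \<sigma>) =
      (\<Sum>\<sigma>\<in>falling_alternating (Suc m). word_wt p q asc (pad (Suc m) 0 \<sigma>))"
    by (rule sum.cong) (simp_all add: word_wt_pad falling_alternating_def)
  also have "\<dots> = (?F ^^ Suc m) ?\<phi> 1"
    using sum_falling_alternating[of "Suc m" 0 asc p q] assms by (simp del: funpow.simps)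
  \<comment> \<open>From height \<open>1\<close> only the step up survives, with weight
    \<open>1\<close>: truncation makes the down weight \<open>?b (1 - 2)\<close> vanish.\<close>
  also have "\<dots> = (?F ^^ m) ?\<phi> (0 + 2)"
    unfolding funpow_step_Suc by (simp add: numeral_2_eq_2)
  \<comment> \<open>\<open>?b 0 = 0\<close> bars the way below height \<open>2\<close>, the number
    of end zeros.\<close>
  also have "\<dots> = (step (\<lambda>h. ?b (h + 2)) (\<lambda>_. 0) ?b ^^ m) (\<lambda>h. of_bool (h = 0)) 0"
    by (subst funpow_step_shift) simp_all
  also have "\<dots> = (step (\<lambda>_. 1) (\<lambda>_. 0) (\<lambda>h. ?b h * ?b (Suc h)) ^^ m) (\<lambda>h. of_bool (h = 0)) 0"
  proof -
    have "(\<lambda>h. ?b (h - 1 + 2) * ?b h) = (\<lambda>h. ?b h * ?b (Suc h))"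
    proof
      fix h show "?b (h - 1 + 2) * ?b h = ?b h * ?b (Suc h)"
        by (cases h) (simp_all add: mult.commute)
    qed
    moreover have "(\<lambda>h. of_bool (h = 0) * (\<Prod>i<h. ?b (i + 2))) = (\<lambda>h. of_bool (h = 0))"
      by (auto simp: fun_eq_iff)
    ultimately show ?thesis
      using funpow_step_conjugate[where a = "\<lambda>h. ?b (h + 2)" and b = "\<lambda>_. 0" and c = ?b
          and n = m and \<phi> = "\<lambda>h. of_bool (h = 0)" and h = 0]
      by simp
  qed
  finally show ?thesis .
qed

lemma sum_falling_alternating_even:
  fixes p q :: "'a::comm_ring_1"
  assumes "even n" "n \<ge> 1"
  shows "(\<Sum>\<sigma>\<in>falling_alternating n. p ^ pat_2_31 n \<sigma> * q ^ pat_31_2 n \<sigma>) =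
    (step (\<lambda>_. 1) (\<lambda>_. 0) (\<lambda>h. (bracket p q h)\<^sup>2) ^^ n) (\<lambda>h. of_bool (h = 0)) 0"
proof -
  let ?b = "bracket p q"
  let ?F = "step ?b (\<lambda>_. 0) (\<lambda>z. ?b (z - 1))"
  let ?\<phi> = "\<lambda>z. of_bool (z = 1) :: 'a"
  have "(\<Sum>\<sigma>\<in>falling_alternating n. p ^ pat_2_31 n \<sigma> * q ^ pat_31_2 n \<sigma>) =
      (\<Sum>\<sigma>\<in>falling_alternating n. word_wt p q des (pad n (Suc n) \<sigma>))"
    by (rule sum.cong) (simp_all add: word_wt_pad falling_alternating_def)
  also have "\<dots> = (?F ^^ n) ?\<phi> (0 + 1)"
    using sum_falling_alternating[of n "Suc n" des p q] assms by simp
  \<comment> \<open>Here a single end zero remains, so heights are measured from \<open>1\<close>,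
    and both weights of an edge become the same bracket.\<close>
  also have "\<dots> = (step (\<lambda>h. ?b (h + 1)) (\<lambda>_. 0) ?b ^^ n) (\<lambda>h. of_bool (h = 0)) 0"
    by (subst funpow_step_shift) (simp_all del: bracket.simps(2))
  also have "\<dots> = (step (\<lambda>_. 1) (\<lambda>_. 0) (\<lambda>h. (?b h)\<^sup>2) ^^ n) (\<lambda>h. of_bool (h = 0)) 0"
  proof -
    have "(\<lambda>h. ?b (h - 1 + 1) * ?b h) = (\<lambda>h. (?b h)\<^sup>2)"
    proof
      fix h show "?b (h - 1 + 1) * ?b h = (?b h)\<^sup>2"
        by (cases h) (simp_all add: power2_eq_square)
    qed
    moreover have "(\<lambda>h. of_bool (h = 0) * (\<Prod>i<h. ?b (i + 1))) = (\<lambda>h. of_bool (h = 0))"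
      by (auto simp: fun_eq_iff)
    ultimately show ?thesis
      using funpow_step_conjugate[where a = "\<lambda>h. ?b (h + 1)" and b = "\<lambda>_. 0" and c = ?b
          and n = n and \<phi> = "\<lambda>h. of_bool (h = 0)" and h = 0]
      by (simp del: bracket.simps(2))
  qed
  finally show ?thesis .
qed

theorem theorem10:
  fixes n :: nat
  assumes "n \<ge> 1"
  shows "(\<Sum>\<sigma>\<in>perms n. (- 1) ^ wex n \<sigma> * indet_p ^ nest n \<sigma> * indet_q ^ cros n \<sigma>) =
           (if even n then 0
            else (- 1) ^ ((n + 1) div 2) *
              (\<Sum>\<sigma>\<in>falling_alternating n. indet_p ^ pat_2_13 n \<sigma> * indet_q ^ pat_31_2 n \<sigma>)) \<and>
         (\<Sum>\<sigma>\<in>derangements n. (- 1 / indet_q) ^ exc n \<sigma> * indet_p ^ nest n \<sigma> * indet_q ^ cros n \<sigma>) =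
           (if even n
            then (- 1 / indet_q) ^ (n div 2) *
              (\<Sum>\<sigma>\<in>falling_alternating n. indet_p ^ pat_2_31 n \<sigma> * indet_q ^ pat_31_2 n \<sigma>)
            else 0)"
proof (rule conjI)
  obtain m where n: "n = Suc m" using assms by (cases n) auto
  \<comment> \<open>The exponent \<open>(n + 1) div 2\<close> is \<open>m div 2 + 1\<close>; the
    extra \<open>- 1\<close> is the global sign of \<open>signed_sum_perms\<close>.\<close>
  have "(- 1) ^ (Suc m div 2 + 1) = - ((- 1) ^ (m div 2) :: int poly poly fract)" if "even m"
    using that by simp
  then show "(\<Sum>\<sigma>\<in>perms n. (- 1) ^ wex n \<sigma> * indet_p ^ nest n \<sigma> * indet_q ^ cros n \<sigma>) =
      (if even n then 0 else (- 1) ^ ((n + 1) div 2) *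
        (\<Sum>\<sigma>\<in>falling_alternating n. indet_p ^ pat_2_13 n \<sigma> * indet_q ^ pat_31_2 n \<sigma>))"
    unfolding n signed_sum_perms using sum_falling_alternating_odd[of m indet_p indet_q] by simp
  \<comment> \<open>Invertibility of \<open>q\<close> provides \<open>y = - 1 / q\<close> with
    \<open>y * q = - 1\<close>.\<close>
  have "indet_q \<noteq> 0" by (simp add: indet_q_def)
  then have "(- 1 / indet_q) * indet_q = - 1" by simp
  then show "(\<Sum>\<sigma>\<in>derangements n. (- 1 / indet_q) ^ exc n \<sigma> * indet_p ^ nest n \<sigma> * indet_q ^ cros n \<sigma>) =
      (if even n then (- 1 / indet_q) ^ (n div 2) *
        (\<Sum>\<sigma>\<in>falling_alternating n. indet_p ^ pat_2_31 n \<sigma> * indet_q ^ pat_31_2 n \<sigma>) else 0)"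
    using assms by (simp add: signed_sum_derangements sum_falling_alternating_even)
qed

end
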